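(* Let $n\geq 2$ and let $M^n=P^{-1}(0)$ be a non-empty regular algebraic hypersurface in $\mathbb R^{n+1}$ defined by a polynomial $P:\mathbb R^{n+1}\to\mathbb R$ of degree less than or equal to three. If $M^n$ has non-zero constant mean curvature, then $M^n$ is a hypersphere or a round cylinder.
   Context: An algebraic hypersurface in $\mathbb R^{n+1}$ is the zero set $M=P^{-1}(0)$ of a (real) polynomial function $P:\mathbb R^{n+1}\to\mathbb R$. It is called regular if the gradient $\nabla P$ has no zeros on $M$; then $M$ is a properly embedded smooth hypersurface (not assumed connected). $M$ is oriented by the global unit normal vector field $N=\nabla P/|\nabla P|$. The shape operator of $M$ at $p$ is $A v=-dN_p(v)$, $v\in T_pM$, and the mean curvature is $H=\frac1n\operatorname{trace}A$. "Non-zero constant mean curvature" means that there is a real constant $c\neq 0$ such that $H(p)=c$ for every $p\in M$ (the same $c$ on all connected components, with respect to $N$). A hypersphere of $\mathbb R^{n+1}$ is a set $\{x:|x-a|=r\}$ with $a\in\mathbb R^{n+1}$, $r>0$. A round cylinder in $\mathbb R^{n+1}$ is a set which, up to a rigid motion of $\mathbb R^{n+1}$, equals $S^k\times\mathbb R^{n-k}$ for some $1\leq k\leq n-1$, where $S^k$ is a hypersphere of $\mathbb R^{k+1}$. *)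

theory Defs
  imports "HOL-Analysis.Analysis"
begin

text \<open>
  The ambient space $\mathbb{R}^{n+1}$ is \<open>real ^ 'm\<close> with \<open>CARD('m) = n + 1\<close>.
\<close>

subsection \<open>Polynomial functions of bounded degree\<close>

text \<open>
  A multi-index is a function \<open>\<alpha> :: 'm \<Rightarrow> nat\<close>; its order is the sum of its entries. The sum
  below has finitely many terms (lemma \<open>finite_multi_indices\<close>), so it is never truncated to 0
  by the convention on infinite sums.
\<close>

definition polynomial_degree_le :: "nat \<Rightarrow> (real ^ 'm \<Rightarrow> real) \<Rightarrow> bool" where
  "polynomial_degree_le d P \<longleftrightarrow>
     (\<exists>a :: ('m \<Rightarrow> nat) \<Rightarrow> real. \<forall>x.
        P x = (\<Sum>\<alpha> | (\<Sum>i\<in>UNIV. \<alpha> i) \<le> d. a \<alpha> * (\<Prod>i\<in>UNIV. (x $ i) ^ \<alpha> i)))"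

lemma finite_multi_indices: "finite {\<alpha> :: 'm::finite \<Rightarrow> nat. (\<Sum>i\<in>UNIV. \<alpha> i) \<le> d}"
proof (rule finite_subset)
  show "{\<alpha> :: 'm \<Rightarrow> nat. (\<Sum>i\<in>UNIV. \<alpha> i) \<le> d} \<subseteq> PiE UNIV (\<lambda>_. {..d})"
  proof
    fix \<alpha> :: "'m \<Rightarrow> nat"
    assume "\<alpha> \<in> {\<alpha>. (\<Sum>i\<in>UNIV. \<alpha> i) \<le> d}"
    moreover have "\<alpha> i \<le> (\<Sum>i\<in>UNIV. \<alpha> i)" for i
      by (rule member_le_sum) auto
    ultimately show "\<alpha> \<in> PiE UNIV (\<lambda>_. {..d})"
      using order_trans by (fastforce simp: PiE_def extensional_def)
  qed
  show "finite (PiE (UNIV :: 'm set) (\<lambda>_. {..d}))"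
    by (rule finite_PiE) auto
qed

subsection \<open>Geometry of a regular level set\<close>

definition zero_set :: "(real ^ 'm \<Rightarrow> real) \<Rightarrow> (real ^ 'm) set" where
  "zero_set P = {x. P x = 0}"

definition gradient :: "(real ^ 'm \<Rightarrow> real) \<Rightarrow> real ^ 'm \<Rightarrow> real ^ 'm" where
  "gradient P x = (\<chi> i. frechet_derivative P (at x) (axis i 1))"

definition regular_hypersurface :: "(real ^ 'm \<Rightarrow> real) \<Rightarrow> bool" where
  "regular_hypersurface P \<longleftrightarrow> (\<forall>p\<in>zero_set P. gradient P p \<noteq> 0)"

definition unit_normal :: "(real ^ 'm \<Rightarrow> real) \<Rightarrow> real ^ 'm \<Rightarrow> real ^ 'm" where
  "unit_normal P x = gradient P x /\<^sub>R norm (gradient P x)"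

text \<open>
  At a point of a regular level set the orthogonal complement of the unit normal is the kernel of
  the differential of \<open>P\<close>, that is, the tangent space of the level set.
\<close>

definition tangent_space :: "(real ^ 'm \<Rightarrow> real) \<Rightarrow> real ^ 'm \<Rightarrow> (real ^ 'm) set" where
  "tangent_space P p = {v. unit_normal P p \<bullet> v = 0}"

text \<open>
  The formula for the normal field makes sense on the open set where the gradient does not
  vanish. On tangent vectors, its derivative there agrees with the differential of its
  restriction to the hypersurface.
\<close>

definition shape_operator :: "(real ^ 'm \<Rightarrow> real) \<Rightarrow> real ^ 'm \<Rightarrow> real ^ 'm \<Rightarrow> real ^ 'm" where
  "shape_operator P p v = - frechet_derivative (unit_normal P) (at p) v"

text \<open>
  Trace of an endomorphism \<open>f\<close> of a subspace \<open>V\<close>: the sum of the diagonal entries of its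
  matrix in a basis. By lemma \<open>trace_on_eq\<close> the choice of basis is immaterial.
\<close>

definition trace_on :: "'a::euclidean_space set \<Rightarrow> ('a \<Rightarrow> 'a) \<Rightarrow> real" where
  "trace_on V f =
     (let B = (SOME B. independent B \<and> span B = V) in \<Sum>b\<in>B. representation B (f b) b)"

lemma trace_basis_independent:
  fixes B C :: "'a::euclidean_space set"
  assumes B: "independent B" "span B = V" and C: "independent C" "span C = V"
    and f: "linear f" "f ` V \<subseteq> V"
  shows "(\<Sum>b\<in>B. representation B (f b) b) = (\<Sum>c\<in>C. representation C (f c) c)"
proof -
  have fin: "finite B" "finite C"
    using B C by (auto intro: independent_imp_finite)
  have fB: "f b \<in> span B" if "b \<in> V" for b using that f B by auto
  have BV: "b \<in> V" if "b \<in> B" for b using that B span_superset by blast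
  have CV: "c \<in> V" if "c \<in> C" for c using that C span_superset by blast
  have 1: "representation B (f b) b = (\<Sum>c\<in>C. representation C b c * representation B (f c) b)"
    if "b \<in> B" for b
  proof -
    have "(\<Sum>c\<in>C. representation C b c *\<^sub>R c) = b"
      using C fin BV that by (intro real_vector.sum_representation_eq) auto
    then have "f b = f (\<Sum>c\<in>C. representation C b c *\<^sub>R c)" by simp
    also have "\<dots> = (\<Sum>c\<in>C. representation C b c *\<^sub>R f c)"
      by (simp add: linear_sum[OF f(1)] linear_scale[OF f(1)])
    finally have eq: "f b = (\<Sum>c\<in>C. representation C b c *\<^sub>R f c)" .
    have "representation B (f b) = (\<lambda>b'. \<Sum>c\<in>C. representation B (representation C b c *\<^sub>R f c) b')"
      unfolding eq using B fB CV
      by (intro real_vector.representation_sum) (auto intro!: span_mul)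
    then show ?thesis
      using B fB CV by (simp add: real_vector.representation_scale)
  qed
  have 2: "representation C (f c) c = (\<Sum>b\<in>B. representation C b c * representation B (f c) b)"
    if "c \<in> C" for c
  proof -
    have eq: "(\<Sum>b\<in>B. representation B (f c) b *\<^sub>R b) = f c"
      using B fin fB CV that by (intro real_vector.sum_representation_eq) auto
    have "representation C (\<Sum>b\<in>B. representation B (f c) b *\<^sub>R b)
        = (\<lambda>c'. \<Sum>b\<in>B. representation C (representation B (f c) b *\<^sub>R b) c')"
      using C BV by (intro real_vector.representation_sum) (auto intro!: span_mul)
    then show ?thesis
      using C BV by (simp add: eq real_vector.representation_scale mult.commute)
  qed
  show ?thesis
    by (simp add: 1 2) (rule sum.swap)
qed

lemma trace_on_eq:
  fixes B :: "'a::euclidean_space set"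
  assumes "independent B" "span B = V" "linear f" "f ` V \<subseteq> V"
  shows "trace_on V f = (\<Sum>b\<in>B. representation B (f b) b)"
proof -
  define C where "C = (SOME B. independent B \<and> span B = V)"
  have "independent C \<and> span C = V"
    unfolding C_def using assms(1,2) by (intro someI) blast
  then show ?thesis
    using assms trace_basis_independent[of C V B f] by (simp add: trace_on_def C_def Let_def)
qed

definition mean_curvature :: "(real ^ 'm \<Rightarrow> real) \<Rightarrow> real ^ 'm \<Rightarrow> real" where
  "mean_curvature P p =
     trace_on (tangent_space P p) (shape_operator P p) / real (CARD('m) - 1)"

definition nonzero_constant_mean_curvature :: "(real ^ 'm \<Rightarrow> real) \<Rightarrow> bool" where
  "nonzero_constant_mean_curvature P \<longleftrightarrow>
     (\<exists>c. c \<noteq> 0 \<and> (\<forall>p\<in>zero_set P. mean_curvature P p = c))"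

subsection \<open>Hyperspheres and round cylinders\<close>

definition hypersphere :: "(real ^ 'm) set \<Rightarrow> bool" where
  "hypersphere M \<longleftrightarrow> (\<exists>a r. r > 0 \<and> M = sphere a r)"

definition rigid_motion :: "(real ^ 'm \<Rightarrow> real ^ 'm) \<Rightarrow> bool" where
  "rigid_motion T \<longleftrightarrow> (\<exists>t Q. orthogonal_transformation Q \<and> T = (\<lambda>x. t + Q x))"

text \<open>
  A set \<open>I\<close> of \<open>k + 1\<close> coordinates splits the ambient space as
  $\mathbb{R}^{k+1} \times \mathbb{R}^{n-k}$. The set below is the product of the sphere of centre
  \<open>(a $ i)\<^sub>i\<close>, \<open>i \<in> I\<close>, and radius \<open>r\<close> in the first factor with the whole second factor.
\<close>

definition coordinate_cylinder :: "'m set \<Rightarrow> real ^ 'm \<Rightarrow> real \<Rightarrow> (real ^ 'm) set" where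
  "coordinate_cylinder I a r = {x. L2_set (\<lambda>i. x $ i - a $ i) I = r}"

text \<open>The range \<open>1 \<le> k \<le> n - 1\<close> is written with \<open>CARD('m) = n + 1\<close>, without subtraction.\<close>

definition round_cylinder :: "(real ^ 'm) set \<Rightarrow> bool" where
  "round_cylinder M \<longleftrightarrow>
     (\<exists>k I a r T. 1 \<le> k \<and> k + 2 \<le> CARD('m) \<and> card I = k + 1 \<and> r > 0 \<and>
        rigid_motion T \<and> M = T ` coordinate_cylinder I a r)"

end

theory Submission
  imports Defs "HOL-Real_Asymp.Real_Asymp"
begin

text \<open>
  Constant mean curvature \<open>c \<noteq> 0\<close> forces the gradient of \<open>P\<close> to be bounded, on the zero set, by a
  multiple of the second derivative of \<open>P\<close>. If \<open>P\<close> has degree three, the gradient grows quadratically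
  and the second derivative linearly along a branch going to infinity, unless the cubic part is
  singular at all its zeros; a real cubic form with this property is the cube of a linear form \<open>\<xi>\<close>.
  Then the second derivative is bounded by a multiple of \<open>1 + \<bar>\<xi>\<bar>\<close>, and comparing growth rates again
  shows that \<open>P\<close> depends on \<open>\<xi>\<close> only, so that the zero set consists of hyperplanes, which contradicts
  \<open>c \<noteq> 0\<close>. Hence \<open>P\<close> is quadratic with bounded gradient on its zero set, which is therefore
  \<open>{x. S (x - a) \<bullet> (x - a) = 1}\<close> with \<open>S\<close> symmetric positive semidefinite. The mean curvatures at the
  vertices on the axes of the largest and of the smallest positive eigenvalue agree only if these
  eigenvalues are equal.
\<close>

subsection \<open>Mean curvature in orthonormal bases\<close>

lemma representation_orthonormal:
  fixes B :: "'a::euclidean_space set"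
  assumes "pairwise orthogonal B" "\<And>b. b \<in> B \<Longrightarrow> norm b = 1" "w \<in> span B" "b \<in> B"
  shows "representation B w b = w \<bullet> b"
proof -
  have ind: "independent B"
    using assms(1,2) by (intro pairwise_orthogonal_independent) fastforce+
  then have fin: "finite B" by (rule independent_imp_finite)
  have "w \<bullet> b = (\<Sum>c\<in>B. representation B w c *\<^sub>R c) \<bullet> b"
    using ind fin assms(3) by (subst real_vector.sum_representation_eq) auto
  also have "\<dots> = (\<Sum>c\<in>B. if c = b then representation B w c else 0)"
    unfolding inner_sum_left
    using assms(1,2,4)
    by (intro sum.cong) (auto simp: pairwise_def orthogonal_def dot_square_norm)
  also have "\<dots> = representation B w b"
    using fin assms(4) by simp
  finally show ?thesis by simp
qed

lemma trace_orthonormal: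
  fixes B :: "'a::euclidean_space set"
  assumes B: "pairwise orthogonal B" "\<And>b. b \<in> B \<Longrightarrow> norm b = 1" "span B = V"
    and f: "linear f" "f ` V \<subseteq> V"
  shows "trace_on V f = (\<Sum>b\<in>B. f b \<bullet> b)"
proof -
  have "independent B"
    using B by (intro pairwise_orthogonal_independent) fastforce+
  then have "trace_on V f = (\<Sum>b\<in>B. representation B (f b) b)"
    using assms by (intro trace_on_eq) auto
  also have "\<dots> = (\<Sum>b\<in>B. f b \<bullet> b)"
    using B f by (intro sum.cong refl representation_orthonormal) (auto simp: span_base)
  finally show ?thesis .
qed

text \<open>By the quotient rule the derivative of the unit normal at \<open>v\<close> is
  \<open>D v\<close> divided by \<open>norm (G p)\<close>, up to a multiple of \<open>G p\<close>,
  and that multiple is invisible against tangent vectors. So only the second derivative of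
  \<open>P\<close> on the tangent space enters.\<close>

lemma mean_curvature_orthonormal:
  fixes P :: "real ^ 'm \<Rightarrow> real"
  assumes G: "gradient P = G" and D: "(G has_derivative D) (at p)" and nz: "G p \<noteq> 0"
    and card: "CARD('m) \<ge> 2"
    and B: "pairwise orthogonal B" "\<And>b. b \<in> B \<Longrightarrow> norm b = 1" "span B = {v. G p \<bullet> v = 0}"
  shows "mean_curvature P p * real (CARD('m) - 1) * norm (G p) = - (\<Sum>b\<in>B. D b \<bullet> b)"
proof -
  \<comment> \<open>Minus the derivative of the unit normal. The multiple of \<open>G p\<close>
    cancels the normal component, so that the tangent space is mapped into itself, as the trace
    formula requires.\<close>
  define S where "S v = - (inverse (norm (G p)) *\<^sub>R D v) + ((G p \<bullet> D v) / norm (G p) ^ 3) *\<^sub>R G p" for v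
  have "(unit_normal P has_derivative (\<lambda>v. - S v)) (at p)"
    unfolding unit_normal_def[abs_def] G
    by (rule derivative_eq_intros refl D nz has_derivative_norm[THEN has_derivative_compose[OF D]] | simp add: nz)+
       (simp add: S_def fun_eq_iff sgn_div_norm nz power3_eq_cube field_simps inner_commute)
  then have shape: "shape_operator P p = S"
    unfolding shape_operator_def by (simp add: frechet_derivative_at[symmetric] fun_eq_iff)
  have tan: "tangent_space P p = {v. G p \<bullet> v = 0}"
    using nz by (auto simp: tangent_space_def unit_normal_def G)
  have linD: "linear D"
    using D has_derivative_linear by blast
  have linS: "linear S"
    unfolding S_def
    by (auto intro!: linearI simp: linear_add[OF linD] linear_scale[OF linD] algebra_simps add_divide_distrib)
  have SV: "S ` {v. G p \<bullet> v = 0} \<subseteq> {v. G p \<bullet> v = 0}"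
    using nz by (auto simp: S_def inner_simps dot_square_norm field_simps power2_eq_square power3_eq_cube)
  have "trace_on (tangent_space P p) (shape_operator P p) = (\<Sum>b\<in>B. S b \<bullet> b)"
    unfolding tan shape by (intro trace_orthonormal B linS SV)
  also have "\<dots> = (\<Sum>b\<in>B. - (D b \<bullet> b) / norm (G p))"
  proof (intro sum.cong refl)
    fix b assume "b \<in> B"
    then have "G p \<bullet> b = 0" using B(3) span_base by blast
    then show "S b \<bullet> b = - (D b \<bullet> b) / norm (G p)"
      by (simp add: S_def inner_simps field_simps)
  qed
  also have "\<dots> = - (\<Sum>b\<in>B. D b \<bullet> b) / norm (G p)"
    by (simp add: sum_divide_distrib sum_negf)
  finally show ?thesis
    using nz card by (simp add: mean_curvature_def field_simps)
qed

text \<open>Adjoining the unit normal to an orthonormal basis of the hyperplane gives an orthonormal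
  basis of the whole space, and there the trace can be computed in \<open>Basis\<close> just as
  well.\<close>

lemma trace_Basis_split:
  fixes D :: "'a::euclidean_space \<Rightarrow> 'a"
  assumes D: "linear D" and N: "norm N = 1"
    and B: "pairwise orthogonal B" "\<And>b. b \<in> B \<Longrightarrow> norm b = 1" "span B = {v. N \<bullet> v = 0}"
  shows "(\<Sum>b\<in>Basis. D b \<bullet> b) = D N \<bullet> N + (\<Sum>b\<in>B. D b \<bullet> b)"
proof -
  have fin: "finite B"
    using B by (intro independent_imp_finite pairwise_orthogonal_independent) fastforce+
  have NB: "N \<bullet> b = 0" if "b \<in> B" for b
    using B(3) that span_base by blast
  have "N \<notin> B" using NB N by force
  have "span (insert N B) = UNIV"
  proof -
    have "v \<in> span (insert N B)" for v
    proof -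
      have "v - (N \<bullet> v) *\<^sub>R N \<in> span B"
        using N by (simp add: B(3) inner_simps dot_square_norm)
      then show ?thesis by (auto simp: span_insert)
    qed
    then show ?thesis by auto
  qed
  then have "trace_on UNIV D = (\<Sum>b\<in>insert N B. D b \<bullet> b)"
    using B N NB D
    by (intro trace_orthonormal) (auto simp: pairwise_insert orthogonal_def inner_commute)
  moreover have "trace_on UNIV D = (\<Sum>b\<in>Basis. D b \<bullet> b)"
    using D by (intro trace_orthonormal)
      (auto simp: pairwise_def orthogonal_def inner_not_same_Basis)
  ultimately show ?thesis
    using \<open>N \<notin> B\<close> fin by simp
qed

lemma obtain_orthonormal_hyperplane_basis:
  fixes g :: "'a::euclidean_space"
  assumes "g \<noteq> 0"
  obtains B where "pairwise orthogonal B" "\<And>b. b \<in> B \<Longrightarrow> norm b = 1"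
    "span B = {v. g \<bullet> v = 0}" "card B = DIM('a) - 1"
proof -
  obtain B where B: "B \<subseteq> {v. g \<bullet> v = 0}" "pairwise orthogonal B" "\<And>x. x \<in> B \<Longrightarrow> norm x = 1"
    "independent B" "card B = dim {v. g \<bullet> v = 0}" "span B = {v. g \<bullet> v = 0}"
    using orthonormal_basis_subspace[OF subspace_hyperplane] by metis
  then show ?thesis
    using that[OF B(2,3,6)] dim_hyperplane[OF assms] by simp
qed

text \<open>The mean curvature averages \<open>CARD('m) - 1\<close> diagonal entries, each of
  modulus at most \<open>K\<close> before division by \<open>norm (G p)\<close>. Through this bound
  constant mean curvature controls the growth of the gradient.\<close>

lemma mean_curvature_bound:
  fixes P :: "real ^ 'm \<Rightarrow> real"
  assumes "gradient P = G" "(G has_derivative D) (at p)" "G p \<noteq> 0" "CARD('m) \<ge> 2"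
    and K: "\<And>v. G p \<bullet> v = 0 \<Longrightarrow> norm v = 1 \<Longrightarrow> \<bar>D v \<bullet> v\<bar> \<le> K"
  shows "\<bar>mean_curvature P p\<bar> * norm (G p) \<le> K"
proof -
  obtain B where B: "pairwise orthogonal B" "\<And>b. b \<in> B \<Longrightarrow> norm b = 1"
    "span B = {v. G p \<bullet> v = 0}" "card B = DIM(real^'m) - 1"
    using obtain_orthonormal_hyperplane_basis[OF assms(3)] by metis
  have "\<bar>mean_curvature P p\<bar> * norm (G p) * real (CARD('m) - 1) = \<bar>\<Sum>b\<in>B. D b \<bullet> b\<bar>"
    using arg_cong[OF mean_curvature_orthonormal[OF assms(1-4) B(1-3)], of abs]
    by (simp add: abs_mult mult_ac)
  also have "\<dots> \<le> (\<Sum>b\<in>B. \<bar>D b \<bullet> b\<bar>)" by (rule sum_abs)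
  also have "\<dots> \<le> real (card B) * K"
    using B K span_base by (intro sum_bounded_above) blast
  finally show ?thesis using B(4) assms(4) by simp
qed

text \<open>Trading the tangential trace for the full trace minus the normal entry removes the
  choice of a tangent basis. The curvature at the vertices of a quadric is computed in this
  form.\<close>

lemma mean_curvature_trace:
  fixes P :: "real ^ 'm \<Rightarrow> real"
  assumes "gradient P = G" "(G has_derivative D) (at p)" "G p \<noteq> 0" "CARD('m) \<ge> 2"
  shows "mean_curvature P p * real (CARD('m) - 1) * norm (G p)
    = D (sgn (G p)) \<bullet> sgn (G p) - (\<Sum>b\<in>Basis. D b \<bullet> b)"
proof -
  obtain B where B: "pairwise orthogonal B" "\<And>b. b \<in> B \<Longrightarrow> norm b = 1"
    "span B = {v. G p \<bullet> v = 0}"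
    using obtain_orthonormal_hyperplane_basis[OF assms(3)] by metis
  have "span B = {v. sgn (G p) \<bullet> v = 0}"
    using B(3) assms(3) by (simp add: sgn_div_norm)
  then have "(\<Sum>b\<in>Basis. D b \<bullet> b) = D (sgn (G p)) \<bullet> sgn (G p) + (\<Sum>b\<in>B. D b \<bullet> b)"
    using has_derivative_linear[OF assms(2)] assms(3) B(1,2)
    by (intro trace_Basis_split) (auto simp: norm_sgn)
  then show ?thesis
    using mean_curvature_orthonormal[OF assms(1-4) B] by simp
qed

subsection \<open>Polynomials of degree three and their leading forms\<close>

lemma real_cubic_has_root:
  fixes p q r :: real
  obtains t where "t ^ 3 + p * t\<^sup>2 + q * t + r = 0"
proof -
  define f where "f t = t ^ 3 + p * t\<^sup>2 + q * t + r" for t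
  have "filterlim f at_top at_top" unfolding f_def by real_asymp
  then have "\<forall>\<^sub>F t in at_top. 0 \<le> f t" unfolding filterlim_at_top by blast
  then have "\<forall>\<^sub>F t in at_top. 0 \<le> f t \<and> 0 \<le> t"
    using eventually_ge_at_top by (rule eventually_conj)
  then obtain t2 where t2: "0 \<le> f t2" "0 \<le> t2"
    using eventually_happens'[OF trivial_limit_at_top_linorder] by blast
  have "filterlim f at_bot at_bot" unfolding f_def by real_asymp
  then have "\<forall>\<^sub>F t in at_bot. f t \<le> 0" unfolding filterlim_at_bot by blast
  then have "\<forall>\<^sub>F t in at_bot. f t \<le> 0 \<and> t \<le> 0"
    using eventually_le_at_bot by (rule eventually_conj)
  then obtain t1 where t1: "f t1 \<le> 0" "t1 \<le> 0"
    using eventually_happens'[OF trivial_limit_at_bot_linorder] by blast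
  have "continuous_on {t1..t2} f" unfolding f_def by (intro continuous_intros)
  then show ?thesis
    using IVT'[of f t1 0 t2] t1 t2 that unfolding f_def by auto
qed

text \<open>The cubic part is polarised: \<open>\<sigma> u v \<bullet> w\<close> is its trilinear
  form, with the third argument moved out by the inner product. The two symmetry axioms for
  \<open>\<sigma>\<close> generate all permutations of the arguments, so gradient and second
  derivative can be written without coordinates.\<close>

locale cubic_function =
  fixes \<sigma> :: "'a::euclidean_space \<Rightarrow> 'a \<Rightarrow> 'a" and A :: "'a \<Rightarrow> 'a" and b :: 'a and \<gamma> :: real
  assumes bil: "bilinear \<sigma>"
    and \<sigma>_commute: "\<sigma> u v = \<sigma> v u"
    and \<sigma>_symmetric: "\<sigma> u v \<bullet> w = \<sigma> u w \<bullet> v"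
    and linear_A: "linear A"
    and A_symmetric: "A u \<bullet> v = u \<bullet> A v"
begin

definition poly :: "'a \<Rightarrow> real" where
  "poly x = \<sigma> x x \<bullet> x + A x \<bullet> x + b \<bullet> x + \<gamma>"

definition grad :: "'a \<Rightarrow> 'a" where
  "grad x = 3 *\<^sub>R \<sigma> x x + 2 *\<^sub>R A x + b"

definition hess :: "'a \<Rightarrow> 'a \<Rightarrow> 'a" where
  "hess x v = 6 *\<^sub>R \<sigma> x v + 2 *\<^sub>R A v"

lemmas \<sigma>_simps = bilinear_ladd[OF bil] bilinear_radd[OF bil] bilinear_lmul[OF bil] bilinear_rmul[OF bil]
lemmas A_simps = linear_add[OF linear_A] linear_scale[OF linear_A]

lemma bounded_bilinear_\<sigma>: "bounded_bilinear \<sigma>"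
  using bil bilinear_conv_bounded_bilinear by blast

lemma bounded_linear_A: "bounded_linear A"
  using linear_A linear_conv_bounded_linear by blast

lemmas tendsto_\<sigma> = bounded_bilinear.tendsto[OF bounded_bilinear_\<sigma>]
lemmas tendsto_A = bounded_linear.tendsto[OF bounded_linear_A]
lemmas continuous_on_\<sigma> = bounded_bilinear.continuous_on[OF bounded_bilinear_\<sigma>]
lemmas continuous_on_A = bounded_linear.continuous_on[OF bounded_linear_A]

lemma \<sigma>_rotate: "\<sigma> u v \<bullet> w = \<sigma> v w \<bullet> u"
  by (metis \<sigma>_commute \<sigma>_symmetric)

lemma poly_has_derivative: "(poly has_derivative (\<lambda>v. grad x \<bullet> v)) (at x)"
proof -
  have "(poly has_derivative (\<lambda>v. (\<sigma> x x \<bullet> v + (\<sigma> x v + \<sigma> v x) \<bullet> x) + (A x \<bullet> v + A v \<bullet> x) + b \<bullet> v)) (at x)"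
    unfolding poly_def[abs_def]
    by (rule derivative_eq_intros bounded_bilinear.FDERIV[OF bounded_bilinear_\<sigma>]
        bounded_linear.has_derivative[OF bounded_linear_A] refl)+ simp
  moreover have "(\<sigma> x x \<bullet> v + (\<sigma> x v + \<sigma> v x) \<bullet> x) + (A x \<bullet> v + A v \<bullet> x) + b \<bullet> v = grad x \<bullet> v" for v
  proof -
    have "\<sigma> v x \<bullet> x = \<sigma> x x \<bullet> v" "\<sigma> x v \<bullet> x = \<sigma> x x \<bullet> v" "A v \<bullet> x = A x \<bullet> v"
      by (metis \<sigma>_rotate, rule \<sigma>_symmetric, metis A_symmetric inner_commute)
    then show ?thesis
      by (simp only: grad_def inner_add_left inner_scaleR_left)
  qed
  ultimately show ?thesis by simp
qed

lemma grad_has_derivative: "(grad has_derivative hess x) (at x)"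
proof -
  have "(grad has_derivative (\<lambda>v. 3 *\<^sub>R (\<sigma> x v + \<sigma> v x) + 2 *\<^sub>R A v)) (at x)"
    unfolding grad_def[abs_def]
    by (rule derivative_eq_intros bounded_bilinear.FDERIV[OF bounded_bilinear_\<sigma>]
        bounded_linear.has_derivative[OF bounded_linear_A] refl)+ simp
  moreover have "3 *\<^sub>R (\<sigma> x v + \<sigma> v x) + 2 *\<^sub>R A v = hess x v" for v
    unfolding hess_def \<sigma>_commute[of v x] scaleR_2[symmetric] by simp
  ultimately show ?thesis by simp
qed

lemma cubic_expansion:
  "\<sigma> (x + u *\<^sub>R v) (x + u *\<^sub>R v) \<bullet> (x + u *\<^sub>R v)
    = \<sigma> x x \<bullet> x + 3 * u * (\<sigma> x x \<bullet> v) + 3 * u\<^sup>2 * (\<sigma> v v \<bullet> x) + u ^ 3 * (\<sigma> v v \<bullet> v)"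
proof -
  have "\<sigma> v x = \<sigma> x v" "\<sigma> x v \<bullet> x = \<sigma> x x \<bullet> v" "\<sigma> x v \<bullet> v = \<sigma> v v \<bullet> x"
    by (metis \<sigma>_commute \<sigma>_symmetric)+
  then show ?thesis
    by (simp add: \<sigma>_simps inner_simps power2_eq_square power3_eq_cube algebra_simps)
qed

text \<open>
  A zero of the leading form at which its gradient does not vanish would be the direction of a
  branch of the zero set going to infinity, along which the gradient grows quadratically.
\<close>

lemma leading_form_zero_near:
  assumes \<omega>: "\<sigma> \<omega> \<omega> \<bullet> \<omega> = 0" "\<sigma> \<omega> \<omega> \<noteq> 0" and \<delta>: "\<delta> > 0"
  shows "\<exists>s y. 0 < s \<and> s < \<delta> \<and> norm (y - \<omega>) < \<delta> \<and>
    \<sigma> y y \<bullet> y + s * (A y \<bullet> y) + s\<^sup>2 * (b \<bullet> y) + s ^ 3 * \<gamma> = 0"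
proof -
  define g where "g = \<sigma> \<omega> \<omega>"
  \<comment> \<open>For \<open>s > 0\<close> this is
    \<open>s ^ 3 * poly ((1 / s) *\<^sub>R y)\<close>, so its zeros are rescaled zeros of
    \<open>poly\<close>; at \<open>s = 0\<close> only the leading form remains.\<close>
  define \<Phi> where "\<Phi> s y = \<sigma> y y \<bullet> y + s * (A y \<bullet> y) + s\<^sup>2 * (b \<bullet> y) + s ^ 3 * \<gamma>" for s y
  define h where "h u = 3 * u * (g \<bullet> g) + 3 * u\<^sup>2 * (\<sigma> g g \<bullet> \<omega>) + u ^ 3 * (\<sigma> g g \<bullet> g)" for u :: real
  have h: "\<Phi> 0 (\<omega> + u *\<^sub>R g) = h u" for u
    unfolding \<Phi>_def h_def cubic_expansion using \<omega> by (simp add: g_def)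
  have "g \<bullet> g > 0" using \<omega> by (simp add: g_def)
  \<comment> \<open>The leading form has gradient \<open>3 *\<^sub>R g\<close> at
    \<open>\<omega>\<close>, hence changes sign along \<open>g\<close>. The signs at the two ends
    persist for small \<open>s\<close>, and the intermediate value theorem gives a zero between
    them.\<close>
  have "(h has_real_derivative 3 * (g \<bullet> g)) (at 0)"
    unfolding h_def by (rule derivative_eq_intros refl | simp)+
  then obtain d1 d2 where d: "d1 > 0" "\<And>u. 0 < u \<Longrightarrow> u < d1 \<Longrightarrow> h 0 < h u"
      "d2 > 0" "\<And>u. 0 < u \<Longrightarrow> u < d2 \<Longrightarrow> h (- u) < h 0"
    using DERIV_pos_inc_right[of h "3 * (g \<bullet> g)" 0] DERIV_pos_inc_left[of h "3 * (g \<bullet> g)" 0] \<open>g \<bullet> g > 0\<close>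
    by (metis add_0 diff_0 mult_pos_pos zero_less_numeral)
  have "h 0 = 0" by (simp add: h_def)
  have "0 < min d1 (min d2 (\<delta> / (norm g + 1)))"
    using d \<delta> by (simp add: add_nonneg_pos)
  then obtain u where "0 < u" "u < min d1 (min d2 (\<delta> / (norm g + 1)))"
    using dense by blast
  then have u: "0 < u" "u < d1" "u < d2" "u < \<delta> / (norm g + 1)" by simp_all
  then have hu: "0 < h u" "h (- u) < 0" using d \<open>h 0 = 0\<close> by metis+
  have ug: "u * norm g < \<delta>"
  proof -
    have "u * norm g \<le> u * (norm g + 1)" using u by simp
    also have "\<dots> < \<delta>" using u by (simp add: pos_less_divide_eq add_nonneg_pos)
    finally show ?thesis .
  qed
  have lim: "((\<lambda>s. \<Phi> s y) \<longlongrightarrow> \<Phi> 0 y) (at_right 0)" for y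
    unfolding \<Phi>_def by (intro tendsto_intros)
  have "\<forall>\<^sub>F s in at_right 0. \<Phi> s (\<omega> + u *\<^sub>R g) > 0"
    by (rule order_tendstoD(1)[OF lim]) (unfold h, rule hu)
  moreover have "\<forall>\<^sub>F s in at_right 0. \<Phi> s (\<omega> + (- u) *\<^sub>R g) < 0"
    by (rule order_tendstoD(2)[OF lim]) (unfold h, rule hu)
  moreover have "\<forall>\<^sub>F s in at_right 0. 0 < s \<and> s < \<delta>"
    using \<delta> eventually_at_right_less eventually_at_right_real by (auto simp: eventually_at_right_field)
  ultimately have "\<forall>\<^sub>F s in at_right 0. \<Phi> s (\<omega> + u *\<^sub>R g) > 0 \<and> \<Phi> s (\<omega> + (- u) *\<^sub>R g) < 0 \<and> 0 < s \<and> s < \<delta>"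
    by eventually_elim auto
  then obtain s where s: "\<Phi> s (\<omega> + u *\<^sub>R g) > 0" "\<Phi> s (\<omega> + (- u) *\<^sub>R g) < 0" "0 < s" "s < \<delta>"
    using eventually_happens'[OF trivial_limit_at_right_real] by fast
  have "continuous_on {-u..u} (\<lambda>t. \<Phi> s (\<omega> + t *\<^sub>R g))"
    unfolding \<Phi>_def by (intro continuous_intros continuous_on_\<sigma> continuous_on_A)
  then obtain t where t: "- u \<le> t" "t \<le> u" "\<Phi> s (\<omega> + t *\<^sub>R g) = 0"
    using IVT'[of "\<lambda>t. \<Phi> s (\<omega> + t *\<^sub>R g)" "- u" 0 u] s u by fastforce
  have "norm (t *\<^sub>R g) \<le> u * norm g"
    using t by (auto intro!: mult_right_mono)
  then have "norm ((\<omega> + t *\<^sub>R g) - \<omega>) < \<delta>" using ug by simp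
  then show ?thesis using s t unfolding \<Phi>_def by blast
qed

text \<open>Let \<open>y\<close> tend to \<open>\<omega>\<close> and \<open>s\<close> to 0 with
  \<open>(1 / s) *\<^sub>R y\<close> on the zero set. If \<open>\<sigma> \<omega> \<omega>\<close>
  were non-zero, the gradient at these points would be of order \<open>1 / s\<^sup>2\<close>, while
  the linear bound allows only order \<open>1 / s\<close>.\<close>

lemma leading_form_singular:
  assumes K: "\<And>p. poly p = 0 \<Longrightarrow> norm (grad p) \<le> K * (1 + norm p)"
    and \<omega>: "\<sigma> \<omega> \<omega> \<bullet> \<omega> = 0"
  shows "\<sigma> \<omega> \<omega> = 0"
proof (rule ccontr)
  assume nz: "\<sigma> \<omega> \<omega> \<noteq> 0"
  have "\<forall>n. \<exists>s y. 0 < s \<and> s < inverse (real (Suc n)) \<and> norm (y - \<omega>) < inverse (real (Suc n)) \<and>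
    \<sigma> y y \<bullet> y + s * (A y \<bullet> y) + s\<^sup>2 * (b \<bullet> y) + s ^ 3 * \<gamma> = 0"
    by (intro allI leading_form_zero_near \<omega> nz) simp
  then obtain s y where sy: "\<And>n. 0 < s n" "\<And>n. s n < inverse (real (Suc n))"
      "\<And>n. norm (y n - \<omega>) < inverse (real (Suc n))"
      "\<And>n. \<sigma> (y n) (y n) \<bullet> y n + s n * (A (y n) \<bullet> y n) + (s n)\<^sup>2 * (b \<bullet> y n) + (s n) ^ 3 * \<gamma> = 0"
    by metis
  have s0: "s \<longlonglongrightarrow> 0"
    by (rule tendsto_sandwich[OF _ _ tendsto_const LIMSEQ_inverse_real_of_nat])
       (use sy in \<open>auto intro!: always_eventually less_imp_le\<close>)
  have "(\<lambda>n. norm (y n - \<omega>)) \<longlonglongrightarrow> 0"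
    by (rule tendsto_sandwich[OF _ _ tendsto_const LIMSEQ_inverse_real_of_nat])
       (use sy in \<open>auto intro!: always_eventually less_imp_le\<close>)
  then have y0: "y \<longlonglongrightarrow> \<omega>"
    using LIM_zero_iff tendsto_norm_zero_iff by blast
  \<comment> \<open>The gradient bound multiplied by \<open>s\<^sup>2\<close>. In this form both
    sides converge: the vector on the left to \<open>3 *\<^sub>R \<sigma> \<omega> \<omega>\<close>,
    the right side to 0.\<close>
  have le: "norm (3 *\<^sub>R \<sigma> (y n) (y n) + s n *\<^sub>R (2 *\<^sub>R A (y n)) + (s n)\<^sup>2 *\<^sub>R b) \<le> K * (s n * (s n + norm (y n)))" for n
  proof -
    define p where "p = inverse (s n) *\<^sub>R y n"
    have y: "y n = s n *\<^sub>R p" using sy(1)[of n] by (simp add: p_def)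
    have "(s n) ^ 3 * poly p = 0"
      unfolding sy(4)[of n, symmetric] y poly_def
      by (simp add: \<sigma>_simps A_simps power2_eq_square power3_eq_cube algebra_simps)
    then have "poly p = 0" using sy(1)[of n] by simp
    then have "norm (grad p) \<le> K * (1 + norm p)" by (rule K)
    then have "(s n)\<^sup>2 * norm (grad p) \<le> (s n)\<^sup>2 * (K * (1 + norm p))"
      by (intro mult_left_mono) auto
    moreover have "(s n)\<^sup>2 * norm (grad p) = norm ((s n)\<^sup>2 *\<^sub>R grad p)" by simp
    moreover have "(s n)\<^sup>2 *\<^sub>R grad p = 3 *\<^sub>R \<sigma> (y n) (y n) + s n *\<^sub>R (2 *\<^sub>R A (y n)) + (s n)\<^sup>2 *\<^sub>R b"
      unfolding y grad_def by (simp add: \<sigma>_simps A_simps power2_eq_square algebra_simps)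
    moreover have "(s n)\<^sup>2 * (K * (1 + norm p)) = K * (s n * (s n + norm (y n)))"
      using sy(1)[of n] unfolding y by (simp add: power2_eq_square algebra_simps)
    ultimately show ?thesis by simp
  qed
  have "(\<lambda>n. norm (3 *\<^sub>R \<sigma> (y n) (y n) + s n *\<^sub>R (2 *\<^sub>R A (y n)) + (s n)\<^sup>2 *\<^sub>R b))
      \<longlonglongrightarrow> norm (3 *\<^sub>R \<sigma> \<omega> \<omega> + 0 *\<^sub>R (2 *\<^sub>R A \<omega>) + 0\<^sup>2 *\<^sub>R b)"
    by (intro tendsto_intros tendsto_\<sigma> tendsto_A s0 y0)
  moreover have "(\<lambda>n. K * (s n * (s n + norm (y n)))) \<longlonglongrightarrow> K * (0 * (0 + norm \<omega>))"
    by (intro tendsto_intros s0 y0)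
  ultimately have "norm (3 *\<^sub>R \<sigma> \<omega> \<omega> + 0 *\<^sub>R (2 *\<^sub>R A \<omega>) + 0\<^sup>2 *\<^sub>R b) \<le> K * (0 * (0 + norm \<omega>))"
    using le by (intro LIMSEQ_le) auto
  then show False using nz by simp
qed

text \<open>
  On every line in the direction \<open>v\<close> the leading form is a cubic polynomial whose real zeros are
  all multiple, hence a perfect cube.
\<close>

lemma leading_form_cube:
  assumes sing: "\<And>\<omega>. \<sigma> \<omega> \<omega> \<bullet> \<omega> = 0 \<Longrightarrow> \<sigma> \<omega> \<omega> = 0"
    and v: "\<sigma> v v \<bullet> v = 1"
  shows "\<sigma> x x \<bullet> x = (\<sigma> v v \<bullet> x) ^ 3"
proof -
  \<comment> \<open>Since \<open>\<sigma> v v \<bullet> v = 1\<close>, the leading form restricted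
    to the line through \<open>x\<close> in direction \<open>v\<close> is a monic cubic, which has a
    real root.\<close>
  obtain t0 where "t0 ^ 3 + (3 * (\<sigma> v v \<bullet> x)) * t0\<^sup>2 + (3 * (\<sigma> x x \<bullet> v)) * t0 + \<sigma> x x \<bullet> x = 0"
    by (rule real_cubic_has_root)
  then have t0: "\<sigma> (x + t0 *\<^sub>R v) (x + t0 *\<^sub>R v) \<bullet> (x + t0 *\<^sub>R v) = 0"
    unfolding cubic_expansion v by (simp add: algebra_simps)
  define y where "y = x + t0 *\<^sub>R v"
  define \<kappa> where "\<kappa> = \<sigma> v v \<bullet> y"
  have y0: "\<sigma> y y \<bullet> y = 0" using t0 by (simp add: y_def)
  then have y1: "\<sigma> y y = 0" by (rule sing)
  have F: "\<sigma> (y + u *\<^sub>R v) (y + u *\<^sub>R v) \<bullet> (y + u *\<^sub>R v) = 3 * u\<^sup>2 * \<kappa> + u ^ 3" for u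
    unfolding cubic_expansion by (simp add: y0 y1 v \<kappa>_def)
  \<comment> \<open>The value \<open>- 3 * \<kappa>\<close> is the remaining root of
    \<open>u\<^sup>2 * (3 * \<kappa> + u)\<close>. The form must be singular there too, and testing
    \<open>\<sigma>\<close> at that point against \<open>v\<close> gives
    \<open>3 * \<kappa>\<^sup>2 = 0\<close>.\<close>
  have "\<sigma> (y + (- 3 * \<kappa>) *\<^sub>R v) (y + (- 3 * \<kappa>) *\<^sub>R v) = 0"
    by (rule sing) (unfold F, simp add: power2_eq_square power3_eq_cube)
  then have "0 = \<sigma> (y + (- 3 * \<kappa>) *\<^sub>R v) (y + (- 3 * \<kappa>) *\<^sub>R v) \<bullet> v" by simp
  also have "\<dots> = \<sigma> y y \<bullet> v + 2 * (- 3 * \<kappa>) * (\<sigma> y v \<bullet> v) + (- 3 * \<kappa>)\<^sup>2 * (\<sigma> v v \<bullet> v)"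
    by (simp only: \<sigma>_simps inner_simps \<sigma>_commute[of v y]) (simp add: power2_eq_square algebra_simps)
  also have "\<sigma> y v \<bullet> v = \<kappa>" unfolding \<kappa>_def by (rule \<sigma>_rotate)
  finally have "\<kappa> = 0" by (simp add: y1 v power2_eq_square)
  then have "\<sigma> v v \<bullet> x = - t0" by (simp add: \<kappa>_def y_def inner_simps v)
  moreover have "\<sigma> x x \<bullet> x = (- t0) ^ 3"
    using F[of "- t0"] \<open>\<kappa> = 0\<close> by (simp add: y_def)
  ultimately show ?thesis by simp
qed

end

subsection \<open>Leading form a cube\<close>

context cubic_function
begin

text \<open>Suppose \<open>\<mu> = A h \<bullet> h\<close> is non-zero and move far along
  \<open>h\<close>, to \<open>t *\<^sub>R e' + s *\<^sub>R h\<close> on the zero set. The gradient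
  along \<open>h\<close> contains \<open>2 * s * \<mu>\<close>, so its bound forces \<open>s\<close>
  to be at most of order \<open>1 + \<bar>t\<bar>\<close>. Then every term of the equation except
  \<open>t ^ 3\<close> is at most quadratic in \<open>1 + \<bar>t\<bar>\<close>, so
  \<open>t\<close>, and with it \<open>s\<close>, stays bounded.\<close>

lemma cube_quadratic_part_degenerate:
  assumes \<sigma>: "\<And>u v. \<sigma> u v = ((e \<bullet> u) * (e \<bullet> v)) *\<^sub>R e" and e: "e \<noteq> 0"
    and K: "\<And>p. poly p = 0 \<Longrightarrow> norm (grad p) \<le> K * (1 + \<bar>e \<bullet> p\<bar>)"
    and h: "e \<bullet> h = 0"
  shows "A h \<bullet> h = 0"
proof (rule ccontr)
  define e' where "e' = e /\<^sub>R (e \<bullet> e)"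
  define \<mu> \<beta> \<alpha> where "\<mu> = A h \<bullet> h" and "\<beta> = A e' \<bullet> h" and "\<alpha> = A e' \<bullet> e'"
  define K' where "K' = \<bar>K\<bar> * norm h"
  assume "A h \<bullet> h \<noteq> 0"
  then have \<mu>: "\<bar>\<mu>\<bar> > 0" by (simp add: \<mu>_def)
  have ee: "e \<bullet> e' = 1" using e by (simp add: e'_def)
  have comm: "A h \<bullet> e' = \<beta>" unfolding \<beta>_def by (metis A_symmetric inner_commute)
  \<comment> \<open>\<open>C\<close> comes from the gradient bound tested against \<open>h\<close>,
    which gives \<open>s \<le> C * (1 + \<bar>t\<bar>)\<close>. \<open>D\<close> collects the lower
    coefficients of the cubic equation and gives \<open>\<bar>t\<bar> \<le> 1 + 4 * D\<close>. The
    value of \<open>s\<close> exceeds by 1 what both together permit.\<close>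
  define C where "C = (K' + 2 * \<bar>\<beta>\<bar> + \<bar>b \<bullet> h\<bar>) / (2 * \<bar>\<mu>\<bar>)"
  define D where "D = \<bar>\<alpha>\<bar> + 2 * C * \<bar>\<beta>\<bar> + C\<^sup>2 * \<bar>\<mu>\<bar> + \<bar>b \<bullet> e'\<bar> + C * \<bar>b \<bullet> h\<bar> + \<bar>\<gamma>\<bar>"
  have C0: "C \<ge> 0" using \<mu> by (simp add: C_def K'_def)
  have D0: "D \<ge> 0" using C0 by (simp add: D_def)
  define s where "s = C * (2 + 4 * D) + 1"
  have s0: "s > 0" using C0 D0 by (simp add: s_def add_nonneg_pos)
  obtain t where t: "t ^ 3 + \<alpha> * t\<^sup>2 + (2 * s * \<beta> + b \<bullet> e') * t + (s\<^sup>2 * \<mu> + s * (b \<bullet> h) + \<gamma>) = 0"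
    by (rule real_cubic_has_root)
  define p where "p = t *\<^sub>R e' + s *\<^sub>R h"
  have ep: "e \<bullet> p = t" by (simp add: p_def inner_simps ee h)
  have "poly p = 0"
    unfolding t[symmetric] poly_def \<sigma> ep
    by (simp add: ep, simp add: p_def A_simps inner_simps comm \<beta>_def[symmetric] \<mu>_def[symmetric] \<alpha>_def[symmetric]
        power2_eq_square power3_eq_cube algebra_simps)
  then have "\<bar>grad p \<bullet> h\<bar> \<le> K * (1 + \<bar>t\<bar>) * norm h"
    using K[of p] Cauchy_Schwarz_ineq2[of "grad p" h] mult_right_mono[of "norm (grad p)" "K * (1 + \<bar>t\<bar>)" "norm h"]
    by (simp add: ep)
  also have "\<dots> \<le> K' * (1 + \<bar>t\<bar>)"
    unfolding K'_def by (simp add: mult_right_mono mult.assoc mult.left_commute mult.commute[of "norm h"])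
  also have "grad p \<bullet> h = 2 * t * \<beta> + 2 * s * \<mu> + b \<bullet> h"
    unfolding grad_def \<sigma> p_def by (simp add: A_simps inner_simps h \<beta>_def \<mu>_def)
  finally have "\<bar>2 * t * \<beta> + 2 * s * \<mu> + b \<bullet> h\<bar> \<le> K' * (1 + \<bar>t\<bar>)" .
  then have "\<bar>2 * s * \<mu>\<bar> \<le> K' * (1 + \<bar>t\<bar>) + \<bar>2 * t * \<beta>\<bar> + \<bar>b \<bullet> h\<bar>" by linarith
  also have "\<dots> \<le> (K' + 2 * \<bar>\<beta>\<bar> + \<bar>b \<bullet> h\<bar>) * (1 + \<bar>t\<bar>)"
    by (simp add: abs_mult algebra_simps)
  finally have st: "s \<le> C * (1 + \<bar>t\<bar>)"
    using \<mu> s0 by (simp add: C_def field_simps abs_mult)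
  define T where "T = 1 + \<bar>t\<bar>"
  have T: "T \<ge> 1" "\<bar>t\<bar> \<le> T" "s \<le> C * T" using st by (auto simp: T_def)
  have TT: "T \<le> T\<^sup>2" using T by (simp add: power2_eq_square)
  have t2: "t\<^sup>2 \<le> T\<^sup>2" using T by (simp add: abs_le_square_iff[symmetric])
  have stT: "s * \<bar>t\<bar> \<le> C * T\<^sup>2"
    using mult_mono[OF T(3) T(2)] C0 T by (simp add: power2_eq_square)
  have s2: "s\<^sup>2 \<le> C\<^sup>2 * T\<^sup>2"
    using power_mono[OF T(3), of 2] s0 by (simp add: power_mult_distrib)
  have sT: "s \<le> C * T\<^sup>2" using T(3) mult_left_mono[OF TT C0] by linarith
  have "t ^ 3 = - (\<alpha> * t\<^sup>2 + 2 * \<beta> * (s * t) + (b \<bullet> e') * t + s\<^sup>2 * \<mu> + s * (b \<bullet> h) + \<gamma>)"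
    using t by (simp add: algebra_simps)
  then have "\<bar>t ^ 3\<bar> \<le> \<bar>\<alpha> * t\<^sup>2\<bar> + \<bar>2 * \<beta> * (s * t)\<bar> + \<bar>(b \<bullet> e') * t\<bar> + \<bar>s\<^sup>2 * \<mu>\<bar> + \<bar>s * (b \<bullet> h)\<bar> + \<bar>\<gamma>\<bar>"
    by linarith
  also have "\<dots> = \<bar>\<alpha>\<bar> * t\<^sup>2 + 2 * \<bar>\<beta>\<bar> * (s * \<bar>t\<bar>) + \<bar>b \<bullet> e'\<bar> * \<bar>t\<bar> + s\<^sup>2 * \<bar>\<mu>\<bar> + s * \<bar>b \<bullet> h\<bar> + \<bar>\<gamma>\<bar> * 1"
    using s0 by (simp add: abs_mult)
  also have "\<dots> \<le> \<bar>\<alpha>\<bar> * T\<^sup>2 + 2 * \<bar>\<beta>\<bar> * (C * T\<^sup>2) + \<bar>b \<bullet> e'\<bar> * T\<^sup>2 + (C\<^sup>2 * T\<^sup>2) * \<bar>\<mu>\<bar> + (C * T\<^sup>2) * \<bar>b \<bullet> h\<bar> + \<bar>\<gamma>\<bar> * T\<^sup>2"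
    using t2 stT s2 sT T TT by (intro add_mono mult_left_mono mult_right_mono) auto
  also have "\<dots> = D * T\<^sup>2" by (simp add: D_def algebra_simps)
  finally have t3: "\<bar>t\<bar> ^ 3 \<le> D * T\<^sup>2" by (simp add: power_abs)
  have "\<bar>t\<bar> \<le> 1 + 4 * D"
  proof (cases "\<bar>t\<bar> \<le> 1")
    case True
    then show ?thesis using D0 by simp
  next
    case False
    have "T\<^sup>2 \<le> (2 * \<bar>t\<bar>)\<^sup>2" using False by (intro power_mono) (auto simp: T_def)
    then have "\<bar>t\<bar> ^ 3 \<le> D * (2 * \<bar>t\<bar>)\<^sup>2"
      using t3 mult_left_mono[OF _ D0] by (meson order_trans)
    then have "\<bar>t\<bar>\<^sup>2 * \<bar>t\<bar> \<le> \<bar>t\<bar>\<^sup>2 * (4 * D)"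
      by (simp add: power2_eq_square power3_eq_cube mult_ac)
    then show ?thesis
      using False by (subst (asm) mult_le_cancel_left_pos) auto
  qed
  then have "C * T \<le> C * (2 + 4 * D)" using C0 by (intro mult_left_mono) (auto simp: T_def)
  then show False using T(3) by (simp add: s_def)
qed

text \<open>The preceding lemma leaves \<open>poly\<close> affine in the component \<open>y\<close>
  orthogonal to \<open>e\<close>, through the terms \<open>t * (c \<bullet> y)\<close> and
  \<open>d \<bullet> y\<close>. If \<open>c\<close> or \<open>d\<close> were non-zero, the equation
  could be solved for \<open>y\<close> at large \<open>t\<close>, and the gradient along
  \<open>e'\<close> would grow like \<open>t\<^sup>2\<close> against a bound linear in
  \<open>t\<close>.\<close>

lemma cube_depends_on_one_variable:
  assumes \<sigma>: "\<And>u v. \<sigma> u v = ((e \<bullet> u) * (e \<bullet> v)) *\<^sub>R e" and e: "e \<noteq> 0"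
    and K: "\<And>p. poly p = 0 \<Longrightarrow> norm (grad p) \<le> K * (1 + \<bar>e \<bullet> p\<bar>)"
  shows "\<exists>k. grad x = k *\<^sub>R e" "\<forall>h. e \<bullet> h = 0 \<longrightarrow> A h = 0"
proof -
  have A0: "A h \<bullet> h = 0" if "e \<bullet> h = 0" for h
    by (rule cube_quadratic_part_degenerate[OF \<sigma> e K that])
  have A1: "A h \<bullet> k = 0" if "e \<bullet> h = 0" "e \<bullet> k = 0" for h k
  proof -
    have "A (h + k) \<bullet> (h + k) = 0" using that by (intro A0) (simp add: inner_simps)
    moreover have "A k \<bullet> h = A h \<bullet> k" by (metis A_symmetric inner_commute)
    ultimately show ?thesis using A0 that by (simp add: A_simps inner_simps)
  qed
  define e' where "e' = e /\<^sub>R (e \<bullet> e)"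
  have ee: "e \<bullet> e' = 1" using e by (simp add: e'_def)
  define \<alpha> \<beta> where "\<alpha> = A e' \<bullet> e'" and "\<beta> = b \<bullet> e'"
  \<comment> \<open>The components orthogonal to \<open>e\<close> of \<open>2 *\<^sub>R A e'\<close>
    and of \<open>b\<close>: all that couples the hyperplane to the variable
    \<open>t\<close>.\<close>
  define c d where "c = 2 *\<^sub>R A e' - (2 * \<alpha>) *\<^sub>R e" and "d = b - \<beta> *\<^sub>R e"
  have perp: "e \<bullet> y = 0 \<longleftrightarrow> e' \<bullet> y = 0" for y using e by (simp add: e'_def)
  have ec: "e \<bullet> c = 0" unfolding perp c_def by (simp add: inner_simps \<alpha>_def inner_commute ee)
  have ed: "e \<bullet> d = 0" unfolding perp d_def by (simp add: inner_simps \<beta>_def inner_commute ee)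
  have Ae: "A y \<bullet> e' = c \<bullet> y / 2" "A e' \<bullet> y = c \<bullet> y / 2" if "e \<bullet> y = 0" for y
  proof -
    show "A e' \<bullet> y = c \<bullet> y / 2" unfolding c_def using that by (simp add: inner_simps)
    then show "A y \<bullet> e' = c \<bullet> y / 2" by (metis A_symmetric inner_commute)
  qed
  have pol: "poly (t *\<^sub>R e' + y) = t ^ 3 + \<alpha> * t\<^sup>2 + \<beta> * t + \<gamma> + t * (c \<bullet> y) + d \<bullet> y" if "e \<bullet> y = 0" for t y
  proof -
    have "b \<bullet> y = d \<bullet> y" unfolding d_def using that by (simp add: inner_simps)
    then show ?thesis
      unfolding poly_def \<sigma>
      by (simp add: A_simps inner_simps Ae[OF that] that ee A0[OF that] \<alpha>_def \<beta>_def power2_eq_square power3_eq_cube algebra_simps)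
  qed
  have gr: "grad (t *\<^sub>R e' + y) \<bullet> e' = 3 * t\<^sup>2 + 2 * \<alpha> * t + \<beta> + c \<bullet> y" if "e \<bullet> y = 0" for t y
    unfolding grad_def \<sigma>
    by (simp add: A_simps inner_simps Ae[OF that] that ee \<alpha>_def \<beta>_def power2_eq_square algebra_simps)
  define K' where "K' = K * norm e'"
  have bound: "3 * t\<^sup>2 + 2 * \<alpha> * t + \<beta> + c \<bullet> y \<le> K' * (1 + t)"
    if "e \<bullet> y = 0" "t ^ 3 + \<alpha> * t\<^sup>2 + \<beta> * t + \<gamma> + t * (c \<bullet> y) + d \<bullet> y = 0" "t \<ge> 0" for t y
  proof -
    have "norm (grad (t *\<^sub>R e' + y)) \<le> K * (1 + t)"
      using K[of "t *\<^sub>R e' + y"] pol[of y t] that by (simp add: inner_simps ee)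
    then have "grad (t *\<^sub>R e' + y) \<bullet> e' \<le> K * (1 + t) * norm e'"
      using norm_cauchy_schwarz[of "grad (t *\<^sub>R e' + y)" e'] mult_right_mono[OF _ norm_ge_zero[of e']]
      by (meson order_trans)
    then show ?thesis using gr[OF that(1)] by (simp add: K'_def mult_ac)
  qed
  have c0: "c = 0"
  proof (rule ccontr)
    assume "c \<noteq> 0"
    then have cc: "c \<bullet> c \<noteq> 0" by simp
    \<comment> \<open>For \<open>y\<close> a multiple of \<open>c\<close>, the linear terms combine
      to \<open>(t + k) * (c \<bullet> y)\<close>, so the equation holds with
      \<open>c \<bullet> y = - q\<close>. As \<open>q\<close> grows like \<open>t\<^sup>2\<close>,
      the gradient along \<open>e'\<close> grows like \<open>2 * t\<^sup>2\<close>. The condition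
      \<open>t > - k\<close> keeps the denominator positive.\<close>
    define k where "k = (c \<bullet> d) / (c \<bullet> c)"
    have "\<forall>\<^sub>F t in at_top. K' * (1 + t) < 3 * t\<^sup>2 + 2 * \<alpha> * t + \<beta> - (t ^ 3 + \<alpha> * t\<^sup>2 + \<beta> * t + \<gamma>) / (t + k)"
      by real_asymp
    moreover have "\<forall>\<^sub>F t in at_top. t > max 0 (- k)" by (rule eventually_gt_at_top)
    ultimately have "\<forall>\<^sub>F t in at_top. t > max 0 (- k) \<and>
        K' * (1 + t) < 3 * t\<^sup>2 + 2 * \<alpha> * t + \<beta> - (t ^ 3 + \<alpha> * t\<^sup>2 + \<beta> * t + \<gamma>) / (t + k)"
      by eventually_elim simp
    then obtain t where t: "t > max 0 (- k)"
        "K' * (1 + t) < 3 * t\<^sup>2 + 2 * \<alpha> * t + \<beta> - (t ^ 3 + \<alpha> * t\<^sup>2 + \<beta> * t + \<gamma>) / (t + k)"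
      using eventually_happens'[OF trivial_limit_at_top_linorder] by blast
    define q where "q = (t ^ 3 + \<alpha> * t\<^sup>2 + \<beta> * t + \<gamma>) / (t + k)"
    define y where "y = (- q / (c \<bullet> c)) *\<^sub>R c"
    have tk: "t + k > 0" "t \<ge> 0" using t(1) by auto
    have cy: "c \<bullet> y = - q" using cc by (simp add: y_def)
    have "d \<bullet> y = - q * k" using cc by (simp add: y_def k_def inner_commute)
    then have "t * (c \<bullet> y) + d \<bullet> y = - (q * (t + k))"
      unfolding cy by (simp add: algebra_simps)
    also have "q * (t + k) = t ^ 3 + \<alpha> * t\<^sup>2 + \<beta> * t + \<gamma>"
      using tk(1) by (simp add: q_def)
    finally have "t * (c \<bullet> y) + d \<bullet> y = - (t ^ 3 + \<alpha> * t\<^sup>2 + \<beta> * t + \<gamma>)" .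
    then have "3 * t\<^sup>2 + 2 * \<alpha> * t + \<beta> + c \<bullet> y \<le> K' * (1 + t)"
      using tk by (intro bound) (simp_all add: y_def ec)
    then show False using t(2) cy by (simp add: q_def)
  qed
  have d0: "d = 0"
  proof (rule ccontr)
    assume "d \<noteq> 0"
    have "\<forall>\<^sub>F t in at_top. K' * (1 + t) < 3 * t\<^sup>2 + 2 * \<alpha> * t + \<beta>" by real_asymp
    moreover have "\<forall>\<^sub>F t in at_top. t \<ge> (0 :: real)" by (rule eventually_ge_at_top)
    ultimately have "\<forall>\<^sub>F t in at_top. t \<ge> 0 \<and> K' * (1 + t) < 3 * t\<^sup>2 + 2 * \<alpha> * t + \<beta>"
      by eventually_elim simp
    then obtain t where t: "t \<ge> 0" "K' * (1 + t) < 3 * t\<^sup>2 + 2 * \<alpha> * t + \<beta>"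
      using eventually_happens'[OF trivial_limit_at_top_linorder] by blast
    \<comment> \<open>With \<open>c = 0\<close> the gradient along \<open>e'\<close> does not
      involve \<open>y\<close>, so \<open>y\<close> is free to solve the equation through
      \<open>d \<bullet> y\<close>.\<close>
    define y where "y = (- (t ^ 3 + \<alpha> * t\<^sup>2 + \<beta> * t + \<gamma>) / (d \<bullet> d)) *\<^sub>R d"
    have "d \<bullet> y = - (t ^ 3 + \<alpha> * t\<^sup>2 + \<beta> * t + \<gamma>)"
      using \<open>d \<noteq> 0\<close> by (simp add: y_def)
    then have "3 * t\<^sup>2 + 2 * \<alpha> * t + \<beta> + c \<bullet> y \<le> K' * (1 + t)"
      using t(1) by (intro bound) (simp_all add: c0 y_def ed)
    then show False using t(2) c0 by simp
  qed
  have ker: "A h = 0" if h: "e \<bullet> h = 0" for h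
  proof -
    have "A h \<bullet> v = 0" for v
    proof -
      have "A h \<bullet> (v - (e \<bullet> v) *\<^sub>R e') = 0" using h by (intro A1) (simp_all add: inner_simps ee)
      then show ?thesis using Ae(1)[OF h] c0 by (simp add: inner_simps)
    qed
    then show ?thesis using inner_eq_zero_iff by blast
  qed
  then show "\<forall>h. e \<bullet> h = 0 \<longrightarrow> A h = 0" by blast
  have "A (x - (e \<bullet> x) *\<^sub>R e') = 0" by (intro ker) (simp add: inner_simps ee)
  then have "A x = (e \<bullet> x) *\<^sub>R A e'"
    by (simp add: linear_diff[OF linear_A] A_simps)
  moreover have "A e' = \<alpha> *\<^sub>R e" using c0 by (simp add: c_def scaleR_scaleR[symmetric] del: scaleR_scaleR)
  moreover have "b = \<beta> *\<^sub>R e" using d0 by (simp add: d_def)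
  ultimately have "grad x = (3 * ((e \<bullet> x) * (e \<bullet> x)) + 2 * ((e \<bullet> x) * \<alpha>) + \<beta>) *\<^sub>R e"
    unfolding grad_def \<sigma> by (simp add: scaleR_add_left)
  then show "\<exists>k. grad x = k *\<^sub>R e" by blast
qed

end

subsection \<open>Quadrics\<close>

text \<open>Otherwise a short step from \<open>v\<close> in the direction of \<open>- S v\<close>
  would make the form negative; invariance of \<open>W\<close> keeps that step inside
  \<open>W\<close>.\<close>

lemma psd_form_null:
  fixes S :: "'a::real_inner \<Rightarrow> 'a"
  assumes S: "linear S" "\<And>u v. S u \<bullet> v = u \<bullet> S v" and W: "subspace W" "\<And>w. w \<in> W \<Longrightarrow> S w \<in> W"
    and psd: "\<And>w. w \<in> W \<Longrightarrow> S w \<bullet> w \<ge> 0" and v: "v \<in> W" "S v \<bullet> v = 0"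
  shows "S v = 0"
proof -
  \<comment> \<open>The surplus 1 makes \<open>d\<close> positive as well as at least
    \<open>c\<close>, so the step \<open>t = - a / d\<close> bounds the form above by
    \<open>- (a\<^sup>2 / d)\<close>.\<close>
  define a c d where "a = S v \<bullet> S v" and "c = S (S v) \<bullet> S v" and "d = \<bar>c\<bar> + 1"
  have ge: "2 * t * a + t\<^sup>2 * c \<ge> 0" for t
  proof -
    have "0 \<le> S (v + t *\<^sub>R S v) \<bullet> (v + t *\<^sub>R S v)"
      using W v by (intro psd subspace_add subspace_scale)
    moreover have "S (S v) \<bullet> v = a" unfolding a_def by (rule S(2))
    ultimately show ?thesis
      using v(2) by (simp add: linear_add[OF S(1)] linear_scale[OF S(1)] inner_add_left inner_add_right
          a_def[symmetric] c_def[symmetric] power2_eq_square algebra_simps)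
  qed
  have d: "d > 0" "c \<le> d" by (auto simp: d_def)
  have "0 \<le> 2 * (- a / d) * a + (- a / d)\<^sup>2 * c" by (rule ge)
  also have "\<dots> \<le> 2 * (- a / d) * a + (- a / d)\<^sup>2 * d"
    using d by (intro add_left_mono mult_left_mono) auto
  also have "\<dots> = - (a\<^sup>2 / d)" using d by (simp add: power2_eq_square field_simps)
  finally have "a\<^sup>2 \<le> 0" using d by (simp add: divide_le_0_iff)
  then show ?thesis by (simp add: a_def)
qed

text \<open>At a maximum point of the form on the unit sphere of \<open>W\<close>, with value
  \<open>\<kappa>\<close>, the semidefinite form of \<open>\<kappa> *\<^sub>R x - S x\<close>
  vanishes, so \<open>psd_form_null\<close> makes that point an eigenvector. Applied to
  \<open>- S\<close> the lemma yields the least eigenvalue.\<close>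

lemma symmetric_extremal_eigenvector:
  fixes S :: "'a::euclidean_space \<Rightarrow> 'a"
  assumes S: "linear S" "\<And>u v. S u \<bullet> v = u \<bullet> S v" and W: "subspace W" "\<And>w. w \<in> W \<Longrightarrow> S w \<in> W" "W \<noteq> {0}"
  obtains e where "e \<in> W" "norm e = 1" "S e = (S e \<bullet> e) *\<^sub>R e"
    "\<And>w. w \<in> W \<Longrightarrow> S w \<bullet> w \<le> (S e \<bullet> e) * (w \<bullet> w)"
proof -
  obtain w where w: "w \<in> W" "w \<noteq> 0" using W subspace_0 by blast
  have "compact (sphere 0 1 \<inter> W)"
    by (intro compact_Int_closed closed_subspace W compact_sphere)
  moreover have "sgn w \<in> sphere 0 1 \<inter> W"
    using w W(1) by (auto simp: norm_sgn sgn_div_norm subspace_scale)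
  moreover have "continuous_on (sphere 0 1 \<inter> W) (\<lambda>x. S x \<bullet> x)"
    using S(1) by (intro continuous_intros linear_continuous_on) (simp add: linear_conv_bounded_linear)
  ultimately obtain e where e: "e \<in> sphere 0 1 \<inter> W"
      "\<And>x. x \<in> sphere 0 1 \<inter> W \<Longrightarrow> S x \<bullet> x \<le> S e \<bullet> e"
    using continuous_attains_sup[of "sphere 0 1 \<inter> W" "\<lambda>x. S x \<bullet> x"] by blast
  define \<kappa> where "\<kappa> = S e \<bullet> e"
  have le: "S x \<bullet> x \<le> \<kappa> * (x \<bullet> x)" if "x \<in> W" for x
  proof (cases "x = 0")
    case True
    then show ?thesis using linear_0[OF S(1)] by simp
  next
    case False
    have "S (sgn x) \<bullet> sgn x \<le> \<kappa>"
      unfolding \<kappa>_def using that W(1) False by (intro e) (auto simp: norm_sgn sgn_div_norm subspace_scale)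
    then show ?thesis
      using False by (simp add: sgn_div_norm linear_scale[OF S(1)] dot_square_norm power2_eq_square field_simps)
  qed
  have "\<kappa> *\<^sub>R e - S e = 0"
    by (rule psd_form_null[where W = W and S = "\<lambda>x. \<kappa> *\<^sub>R x - S x"])
       (use S W e le in \<open>auto intro!: linear_compose_sub linear_compose_scale_right linear_id[unfolded id_def]
          subspace_diff subspace_scale simp: inner_diff_left inner_diff_right \<kappa>_def dot_square_norm\<close>)
  then show ?thesis using that[of e] e le by (simp add: \<kappa>_def)
qed

text \<open>Up to normalisation, \<open>H\<close> is the mean curvature equation at the vertex of
  the quadric on the axis \<open>v\<close>. The bound \<open>bdd\<close> excludes negative
  eigenvalues, \<open>H\<close> identifies the least positive eigenvalue with the largest, and
  symmetry makes \<open>range S\<close> the eigenspace and its orthogonal complement the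
  kernel.\<close>

lemma quadric_eigenvalues:
  fixes S :: "'a::euclidean_space \<Rightarrow> 'a"
  assumes S: "linear S" "\<And>u v. S u \<bullet> v = u \<bullet> S v"
    and ne: "S y \<bullet> y = 1"
    and bdd: "\<And>y. S y \<bullet> y = 1 \<Longrightarrow> norm (S y) \<le> K"
    and c: "c \<noteq> 0"
    and H: "\<And>\<kappa> v. \<kappa> > 0 \<Longrightarrow> norm v = 1 \<Longrightarrow> S v = \<kappa> *\<^sub>R v \<Longrightarrow> c * sqrt \<kappa> = \<kappa> - (\<Sum>b\<in>Basis. S b \<bullet> b)"
  obtains \<kappa> W where "\<kappa> > 0" "subspace W" "dim W \<ge> 2" "\<And>w. w \<in> W \<Longrightarrow> S w = \<kappa> *\<^sub>R w"
    "\<And>z. (\<And>w. w \<in> W \<Longrightarrow> z \<bullet> w = 0) \<Longrightarrow> S z = 0"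
proof -
  define T where "T = (\<Sum>b\<in>Basis. S b \<bullet> b)"
  have "y \<noteq> 0" using ne by auto
  then have U: "(UNIV :: 'a set) \<noteq> {0}" by blast
  obtain e where e: "norm e = 1" "S e = (S e \<bullet> e) *\<^sub>R e" "\<And>w. S w \<bullet> w \<le> (S e \<bullet> e) * (w \<bullet> w)"
    using symmetric_extremal_eigenvector[OF S subspace_UNIV _ U] by auto
  define \<kappa> where "\<kappa> = S e \<bullet> e"
  have Se: "S e = \<kappa> *\<^sub>R e" using e(2) by (simp add: \<kappa>_def)
  have l0: "\<kappa> > 0"
  proof -
    have "1 \<le> \<kappa> * (y \<bullet> y)" using e(3)[of y] ne by (simp add: \<kappa>_def)
    then show ?thesis by (smt (verit) inner_ge_zero mult_nonpos_nonneg)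
  qed
  have mS: "linear (\<lambda>x. - S x)" "\<And>u v. - S u \<bullet> v = u \<bullet> - S v"
    using S by (auto intro: linear_compose_neg)
  have psd: "S w \<bullet> w \<ge> 0" for w
  proof -
    obtain g where g: "norm g = 1" "S g = (S g \<bullet> g) *\<^sub>R g" "\<And>w. (S g \<bullet> g) * (w \<bullet> w) \<le> S w \<bullet> w"
      using symmetric_extremal_eigenvector[OF mS subspace_UNIV _ U] by auto
    define \<mu> where "\<mu> = S g \<bullet> g"
    have Sg: "S g = \<mu> *\<^sub>R g" using g(2) by (simp add: \<mu>_def)
    have "\<mu> \<ge> 0"
    proof (rule ccontr)
      assume "\<not> \<mu> \<ge> 0"
      then have m: "\<mu> < 0" by simp
      have "\<kappa> * (e \<bullet> g) = \<mu> * (e \<bullet> g)"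
        using S(2)[of e g] by (simp add: Se Sg)
      then have eg: "e \<bullet> g = 0" using m l0 by simp
      \<comment> \<open>A far point on a hyperbola in the plane of \<open>e\<close> and
        \<open>g\<close>: \<open>s\<close> puts \<open>x\<close> on the quadric, and
        \<open>t\<close> gives \<open>S x \<bullet> g\<close> the modulus
        \<open>\<bar>K\<bar> + 1\<close>, contradicting \<open>bdd\<close>.\<close>
      define t where "t = (\<bar>K\<bar> + 1) / \<bar>\<mu>\<bar>"
      define s where "s = sqrt ((1 - \<mu> * t\<^sup>2) / \<kappa>)"
      have "1 - \<mu> * t\<^sup>2 \<ge> 0" using m by (smt (verit) mult_nonpos_nonneg zero_le_power2)
      then have s2: "\<kappa> * s\<^sup>2 = 1 - \<mu> * t\<^sup>2" using l0 by (simp add: s_def)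
      define x where "x = s *\<^sub>R e + t *\<^sub>R g"
      have Sx: "S x = (\<kappa> * s) *\<^sub>R e + (\<mu> * t) *\<^sub>R g"
        by (simp add: x_def linear_add[OF S(1)] linear_scale[OF S(1)] Se Sg mult.commute)
      have "S x \<bullet> x = \<kappa> * s\<^sup>2 + \<mu> * t\<^sup>2"
        unfolding Sx by (simp add: x_def inner_simps eg inner_commute[of g e] e(1) g(1) dot_square_norm power2_eq_square)
      then have "norm (S x) \<le> K" using s2 by (intro bdd) simp
      moreover have "\<bar>S x \<bullet> g\<bar> \<le> norm (S x)" using Cauchy_Schwarz_ineq2[of "S x" g] g(1) by simp
      moreover have "S x \<bullet> g = \<mu> * t"
        unfolding Sx by (simp add: inner_simps eg g(1) dot_square_norm)
      moreover have "\<bar>\<mu> * t\<bar> = \<bar>K\<bar> + 1" using m by (simp add: t_def abs_mult)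
      ultimately show False by linarith
    qed
    then show ?thesis using g(3)[of w] by (smt (verit) \<mu>_def inner_ge_zero mult_nonneg_nonneg)
  qed
  \<comment> \<open>The kernel of the symmetric \<open>S\<close> is orthogonal to its range, so the
    least eigenvalue on \<open>W\<close> is the least positive eigenvalue of
    \<open>S\<close>.\<close>
  define W where "W = range S"
  have W: "subspace W" "\<And>w. S w \<in> W"
    unfolding W_def using S(1) by (auto intro: linear_subspace_image)
  have eW: "e \<in> W"
  proof -
    have "e = S ((1 / \<kappa>) *\<^sub>R e)" using l0 by (simp add: linear_scale[OF S(1)] Se)
    then show ?thesis by (simp add: W_def)
  qed
  then have W0: "W \<noteq> {0}" using e(1) by auto
  obtain g where g: "g \<in> W" "norm g = 1" "S g = (S g \<bullet> g) *\<^sub>R g"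
      "\<And>w. w \<in> W \<Longrightarrow> (S g \<bullet> g) * (w \<bullet> w) \<le> S w \<bullet> w"
    using symmetric_extremal_eigenvector[OF mS W(1) _ W0] W by (auto simp: subspace_neg)
  define \<mu> where "\<mu> = S g \<bullet> g"
  have Sg: "S g = \<mu> *\<^sub>R g" using g(3) by (simp add: \<mu>_def)
  have m0: "\<mu> > 0"
  proof -
    have "\<mu> \<noteq> 0"
    proof
      assume "\<mu> = 0"
      then have "S g = 0" using Sg by simp
      moreover obtain u where "g = S u" using g(1) by (auto simp: W_def)
      ultimately have "g \<bullet> g = 0" using S(2)[of u g] by simp
      then show False using g(2) by simp
    qed
    then show ?thesis using psd[of g] by (simp add: \<mu>_def)
  qed
  have lT: "c * sqrt \<kappa> = \<kappa> - T" unfolding T_def using l0 e(1) Se by (rule H)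
  have mT: "c * sqrt \<mu> = \<mu> - T" unfolding T_def using m0 g(2) Sg by (rule H)
  have "T \<ge> 0" unfolding T_def by (intro sum_nonneg psd)
  have "\<mu> = \<kappa>"
  proof (rule ccontr)
    assume "\<mu> \<noteq> \<kappa>"
    \<comment> \<open>Distinct \<open>p\<close> and \<open>q\<close> would be the two roots of
      \<open>x\<^sup>2 - c * x - T\<close>, with product \<open>- T \<le> 0\<close>, although both
      are positive. Eliminating \<open>c\<close> below expresses this.\<close>
    define p q where "p = sqrt \<kappa>" and "q = sqrt \<mu>"
    have pq: "p > 0" "q > 0" "\<kappa> = p * p" "\<mu> = q * q" "p \<noteq> q"
      using l0 m0 \<open>\<mu> \<noteq> \<kappa>\<close> by (auto simp: p_def q_def)
    have "c * p = p * p - T" "c * q = q * q - T"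
      using lT mT by (simp_all add: p_def[symmetric] q_def[symmetric] pq(3,4)[symmetric])
    then have "(p * p - T) * q = (q * q - T) * p" by (metis mult.assoc mult.commute)
    then have "(p - q) * (p * q + T) = 0" by (simp add: algebra_simps)
    then have "p * q + T = 0" using pq by simp
    then show False using pq \<open>T \<ge> 0\<close> mult_pos_pos[of p q] by linarith
  qed
  have SW: "S w = \<kappa> *\<^sub>R w" if "w \<in> W" for w
  proof -
    have "S w \<bullet> w = \<kappa> * (w \<bullet> w)"
      using g(4)[OF that] e(3)[of w] \<open>\<mu> = \<kappa>\<close> unfolding \<kappa>_def[symmetric] \<mu>_def[symmetric] by simp
    then have "\<kappa> *\<^sub>R w - S w = 0"
      by (intro psd_form_null[where W = UNIV and S = "\<lambda>x. \<kappa> *\<^sub>R x - S x"])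
         (use S e(3) in \<open>auto intro!: linear_compose_sub linear_compose_scale_right linear_id[unfolded id_def]
            simp: inner_diff_left inner_diff_right \<kappa>_def\<close>)
    then show ?thesis by simp
  qed
  \<comment> \<open>In the rank one case \<open>W\<close> is spanned by \<open>e\<close> and the
    trace \<open>T\<close> equals \<open>\<kappa>\<close>, so \<open>H\<close> would give
    \<open>c * sqrt \<kappa> = 0\<close>.\<close>
  have "dim W \<ge> 2"
  proof (rule ccontr)
    assume "\<not> dim W \<ge> 2"
    then have "dim W \<le> 1" by simp
    have "e \<noteq> 0" using e(1) by auto
    then have "span {e} = W"
      using eW W(1) \<open>dim W \<le> 1\<close> span_minimal[of "{e}" W]
      by (intro subspace_dim_equal) (auto simp: dim_span dim_singleton)
    then have Sb: "S x = (S x \<bullet> e) *\<^sub>R e" for x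
    proof -
      have "S x \<in> span {e}" using W(2) \<open>span {e} = W\<close> by simp
      then obtain k where "S x = k *\<^sub>R e" by (auto simp: span_singleton)
      then show ?thesis using e(1) by (simp add: dot_square_norm)
    qed
    have "S b \<bullet> b = \<kappa> * (e \<bullet> b)\<^sup>2" for b
    proof -
      have "S b \<bullet> b = ((S b \<bullet> e) *\<^sub>R e) \<bullet> b" using Sb[of b] by simp
      also have "S b \<bullet> e = \<kappa> * (e \<bullet> b)" using S(2)[of b e] by (simp add: Se inner_commute)
      finally show ?thesis by (simp add: power2_eq_square)
    qed
    then have "T = \<kappa> * (\<Sum>b\<in>Basis. (e \<bullet> b)\<^sup>2)" by (simp add: T_def sum_distrib_left)
    also have "(\<Sum>b\<in>Basis. (e \<bullet> b)\<^sup>2) = e \<bullet> e"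
      by (subst euclidean_inner) (simp add: power2_eq_square)
    finally have "T = \<kappa>" using e(1) by (simp add: dot_square_norm)
    then show False using lT c l0 by simp
  qed
  moreover have "S z = 0" if "\<And>w. w \<in> W \<Longrightarrow> z \<bullet> w = 0" for z
  proof -
    have "S z \<bullet> S z = z \<bullet> S (S z)" by (rule S(2))
    also have "\<dots> = 0" by (rule that[OF W(2)])
    finally show ?thesis by simp
  qed
  ultimately show ?thesis using that[OF l0 W(1)] SW by blast
qed

text \<open>Orthonormal bases of \<open>W\<close> and of its orthogonal complement, indexed by
  \<open>I\<close> and by the complement of \<open>I\<close>, serve as the images of the coordinate
  vectors. This carries a cylinder over \<open>W\<close> to the coordinate form used in
  \<open>round_cylinder\<close>.\<close>

lemma orthogonal_transformation_coordinate_subspace: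
  fixes W :: "(real ^ 'm) set"
  assumes W: "subspace W"
  obtains I :: "'m set" and Q :: "real ^ 'm \<Rightarrow> real ^ 'm" where "card I = dim W" "orthogonal_transformation Q"
    "\<And>i. i \<in> I \<Longrightarrow> Q (axis i 1) \<in> W" "\<And>i w. i \<notin> I \<Longrightarrow> w \<in> W \<Longrightarrow> Q (axis i 1) \<bullet> w = 0"
proof -
  obtain I :: "'m set" where I: "card I = dim W"
    using obtain_subset_with_card_n[of "dim W" "UNIV :: 'm set"] dim_subset_UNIV[of W] by auto
  define V where "V = {y. \<forall>w\<in>W. orthogonal y w}"
  have V: "subspace V" "dim V + dim W = CARD('m)"
  proof -
    show "subspace V" unfolding V_def by (auto simp: subspace_def orthogonal_def inner_simps)
    have "dim V + dim W = dim (UNIV :: (real ^ 'm) set)"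
      using dim_subspace_orthogonal_to_vectors[OF W subspace_UNIV] by (simp add: V_def orthogonal_commute)
    then show "dim V + dim W = CARD('m)" by simp
  qed
  obtain B where B: "B \<subseteq> W" "pairwise orthogonal B" "\<And>x. x \<in> B \<Longrightarrow> norm x = 1" "independent B" "card B = dim W"
    using orthonormal_basis_subspace[OF W] by metis
  obtain C where C: "C \<subseteq> V" "pairwise orthogonal C" "\<And>x. x \<in> C \<Longrightarrow> norm x = 1" "independent C" "card C = dim V"
    using orthonormal_basis_subspace[OF V(1)] by metis
  have fin: "finite B" "finite C" using B C by (auto intro: independent_imp_finite)
  have "card (- I) = card C"
    using I C(5) V(2) by (simp add: Compl_eq_Diff_UNIV card_Diff_subset)
  then obtain g where g: "bij_betw g (- I) C"
    using fin by (metis finite bij_betw_iff_card)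
  obtain f where f: "bij_betw f I B"
    using fin B(5) I by (metis finite bij_betw_iff_card)
  define \<phi> where "\<phi> i = (if i \<in> I then f i else g i)" for i
  have \<phi>B: "\<phi> i \<in> B" if "i \<in> I" for i
    using that f by (auto simp: \<phi>_def bij_betw_def)
  have \<phi>C: "\<phi> i \<in> C" if "i \<notin> I" for i
    using that g by (auto simp: \<phi>_def bij_betw_def)
  have BC: "x \<bullet> y = 0" if "x \<in> B" "y \<in> C" for x y
    using that B(1) C(1) by (subst inner_commute) (auto simp: V_def orthogonal_def)
  have orth: "\<phi> i \<bullet> \<phi> j = (if i = j then 1 else 0)" for i j
  proof (cases "i = j")
    case True
    then show ?thesis using \<phi>B[of i] \<phi>C[of i] B(3) C(3) by (cases "i \<in> I") (auto simp: dot_square_norm)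
  next
    case False
    consider "i \<in> I" "j \<in> I" | "i \<in> I" "j \<notin> I" | "i \<notin> I" "j \<in> I" | "i \<notin> I" "j \<notin> I" by blast
    then have "\<phi> i \<bullet> \<phi> j = 0"
    proof cases
      case 1
      then have "\<phi> i \<noteq> \<phi> j" using False f by (auto simp: \<phi>_def bij_betw_def inj_on_def)
      then show ?thesis using B(2) \<phi>B 1 by (auto simp: pairwise_def orthogonal_def)
    next
      case 2
      then show ?thesis by (intro BC \<phi>B \<phi>C)
    next
      case 3
      then show ?thesis by (subst inner_commute) (intro BC \<phi>B \<phi>C)
    next
      case 4
      then have "\<phi> i \<noteq> \<phi> j" using False g by (auto simp: \<phi>_def bij_betw_def inj_on_def)
      then show ?thesis using C(2) \<phi>C 4 by (auto simp: pairwise_def orthogonal_def)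
    qed
    then show ?thesis using False by simp
  qed
  define Q where "Q x = (\<Sum>i\<in>UNIV. x $ i *\<^sub>R \<phi> i)" for x :: "real ^ 'm"
  have "linear Q"
    by (rule linearI) (simp_all add: Q_def scaleR_add_left sum.distrib scaleR_sum_right)
  moreover have "Q x \<bullet> Q y = x \<bullet> y" for x y
  proof -
    have "Q x \<bullet> Q y = (\<Sum>i\<in>UNIV. x $ i * y $ i)"
      by (simp add: Q_def inner_sum_left inner_sum_right orth if_distrib[of "(*) _"] mult.commute cong: if_cong)
    then show ?thesis by (simp add: inner_vec_def)
  qed
  ultimately have "orthogonal_transformation Q"
    by (simp add: orthogonal_transformation_def)
  moreover have "Q (axis i 1) = \<phi> i" for i
    by (simp add: Q_def axis_def if_distrib[of "\<lambda>c. c *\<^sub>R _"] cong: if_cong)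
  moreover have "\<phi> i \<in> W" if "i \<in> I" for i
    using \<phi>B[OF that] B(1) by blast
  moreover have "\<phi> i \<bullet> w = 0" if "i \<notin> I" "w \<in> W" for i w
    using \<phi>C[OF that(1)] that(2) C(1) by (auto simp: V_def orthogonal_def)
  ultimately show ?thesis
    by (intro that[OF I, of Q]) simp_all
qed

text \<open>On \<open>W\<close> the form is \<open>\<kappa>\<close> times the squared norm and on
  the orthogonal complement it vanishes. Hence the quadric has constant distance
  \<open>sqrt (1 / \<kappa>)\<close> from \<open>a\<close> in the directions of \<open>W\<close> and
  is free in the others.\<close>

lemma umbilic_quadric_classification:
  fixes S :: "real ^ 'm \<Rightarrow> real ^ 'm"
  assumes S: "linear S" and \<kappa>: "\<kappa> > 0" and W: "subspace W" "dim W \<ge> 2"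
    and eig: "\<And>w. w \<in> W \<Longrightarrow> S w = \<kappa> *\<^sub>R w"
    and ker: "\<And>z. (\<And>w. w \<in> W \<Longrightarrow> z \<bullet> w = 0) \<Longrightarrow> S z = 0"
  shows "hypersphere {x. S (x - a) \<bullet> (x - a) = 1} \<or> round_cylinder {x. S (x - a) \<bullet> (x - a) = 1}"
proof -
  let ?M = "{x. S (x - a) \<bullet> (x - a) = 1}"
  define r where "r = sqrt (1 / \<kappa>)"
  have r: "r > 0" "r\<^sup>2 = 1 / \<kappa>" using \<kappa> by (simp_all add: r_def)
  show ?thesis
  proof (cases "W = UNIV")
    case True
    have "S (x - a) \<bullet> (x - a) = 1 \<longleftrightarrow> dist a x = r" for x
    proof -
      have "S (x - a) \<bullet> (x - a) = 1 \<longleftrightarrow> (norm (x - a))\<^sup>2 = r\<^sup>2"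
        using \<kappa> True eig[of "x - a"] by (simp add: r(2) dot_square_norm eq_divide_eq mult.commute)
      also have "\<dots> \<longleftrightarrow> dist a x = r"
        using r(1) by (simp add: dist_norm norm_minus_commute)
      finally show ?thesis .
    qed
    then have "?M = sphere a r" by (auto simp: sphere_def)
    then show ?thesis using r(1) by (auto simp: hypersphere_def)
  next
    case False
    obtain I :: "'m set" and Q :: "real ^ 'm \<Rightarrow> real ^ 'm" where Q: "card I = dim W" "orthogonal_transformation Q"
      "\<And>i. i \<in> I \<Longrightarrow> Q (axis i 1) \<in> W" "\<And>i w. i \<notin> I \<Longrightarrow> w \<in> W \<Longrightarrow> Q (axis i 1) \<bullet> w = 0"
      using orthogonal_transformation_coordinate_subspace[OF W(1)] by metis
    have linQ: "linear Q" using Q(2) by (simp add: orthogonal_transformation_def)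
    have SQ: "S (Q y) \<bullet> Q y = \<kappa> * (\<Sum>i\<in>I. (y $ i)\<^sup>2)" for y
    proof -
      have y: "y = (\<Sum>i\<in>UNIV. y $ i *\<^sub>R axis i 1)"
        using basis_expansion[of y] by (simp add: scalar_mult_eq_scaleR)
      have "S (Q y) = S (Q (\<Sum>i\<in>UNIV. y $ i *\<^sub>R axis i 1))" using y by simp
      also have "\<dots> = (\<Sum>i\<in>UNIV. y $ i *\<^sub>R S (Q (axis i 1)))"
        by (simp add: linear_sum[OF linQ] linear_scale[OF linQ] linear_sum[OF S] linear_scale[OF S])
      also have "\<dots> = (\<Sum>i\<in>UNIV. if i \<in> I then (\<kappa> * y $ i) *\<^sub>R Q (axis i 1) else 0)"
        using Q eig ker by (intro sum.cong) auto
      finally have "S (Q y) = (\<Sum>i\<in>I. (\<kappa> * y $ i) *\<^sub>R Q (axis i 1))"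
        by (simp add: sum.If_cases)
      then have "S (Q y) \<bullet> Q y = (\<Sum>i\<in>I. (\<kappa> * y $ i) * (Q (axis i 1) \<bullet> Q y))"
        by (simp add: inner_sum_left)
      also have "\<dots> = (\<Sum>i\<in>I. (\<kappa> * y $ i) * y $ i)"
        using Q(2) by (simp add: orthogonal_transformation_def inner_axis')
      finally show ?thesis by (simp add: sum_distrib_left power2_eq_square mult_ac)
    qed
    have cyl: "y \<in> coordinate_cylinder I 0 r \<longleftrightarrow> S (Q y) \<bullet> Q y = 1" for y
    proof -
      have "y \<in> coordinate_cylinder I 0 r \<longleftrightarrow> sqrt (\<Sum>i\<in>I. (y $ i)\<^sup>2) = sqrt (1 / \<kappa>)"
        by (simp add: coordinate_cylinder_def L2_set_def r_def)
      also have "\<dots> \<longleftrightarrow> S (Q y) \<bullet> Q y = 1"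
        using \<kappa> by (simp only: real_sqrt_eq_iff SQ) (simp add: field_simps)
      finally show ?thesis .
    qed
    have "?M = (\<lambda>x. a + Q x) ` coordinate_cylinder I 0 r"
    proof (intro equalityI subsetI)
      fix x assume "x \<in> ?M"
      moreover obtain y where y: "x - a = Q y"
        using orthogonal_transformation_surj[OF Q(2)] by (metis surjD)
      ultimately have "y \<in> coordinate_cylinder I 0 r" by (simp add: cyl)
      moreover have "x = a + Q y" using y by (simp add: algebra_simps)
      ultimately show "x \<in> (\<lambda>x. a + Q x) ` coordinate_cylinder I 0 r" by blast
    qed (auto simp: cyl)
    moreover have "rigid_motion (\<lambda>x. a + Q x)"
      using Q(2) by (auto simp: rigid_motion_def)
    moreover have "dim W < CARD('m)"
      using False W(1) dim_eq_full[of W] dim_subset_UNIV[of W] by (simp add: span_eq_iff[THEN iffD2] nat_less_le)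
    \<comment> \<open>The sphere factor has dimension \<open>k = dim W - 1\<close>. The two bounds
      on \<open>k\<close> are \<open>dim W \<ge> 2\<close> and
      \<open>dim W < CARD('m)\<close>.\<close>
    ultimately have "round_cylinder ?M"
      unfolding round_cylinder_def using Q(1) W(2) r(1)
      by (intro exI[of _ "dim W - 1"] exI[of _ I] exI[of _ 0] exI[of _ r] exI[of _ "\<lambda>x. a + Q x"]) auto
    then show ?thesis ..
  qed
qed

subsection \<open>Constant mean curvature\<close>

text \<open>The function \<open>P\<close> is a parameter separate from its coefficients, so that the
  same \<open>P\<close> can be presented again with a simpler \<open>\<sigma>\<close> once its cubic
  part is known.\<close>

locale cmc_cubic = cubic_function \<sigma> A b \<gamma>
  for \<sigma> :: "real ^ 'm \<Rightarrow> real ^ 'm \<Rightarrow> real ^ 'm" and A b \<gamma> +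
  fixes P :: "real ^ 'm \<Rightarrow> real" and c :: real
  assumes P_eq: "P = poly"
    and card_ge: "CARD('m) \<ge> 2"
    and regular: "regular_hypersurface P"
    and nonempty: "zero_set P \<noteq> {}"
    and c_nonzero: "c \<noteq> 0"
    and mean_curvature_P: "p \<in> zero_set P \<Longrightarrow> mean_curvature P p = c"
begin

lemma gradient_P: "gradient P = grad"
proof -
  have "frechet_derivative P (at x) = (\<lambda>v. grad x \<bullet> v)" for x
    using poly_has_derivative by (simp add: P_eq frechet_derivative_at[symmetric])
  then show ?thesis
    by (auto simp: gradient_def fun_eq_iff vec_eq_iff inner_axis)
qed

lemma grad_nonzero: "poly p = 0 \<Longrightarrow> grad p \<noteq> 0"
  using regular gradient_P by (auto simp: regular_hypersurface_def zero_set_def P_eq)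

lemma grad_bound:
  assumes "poly p = 0" "\<And>v. grad p \<bullet> v = 0 \<Longrightarrow> norm v = 1 \<Longrightarrow> \<bar>hess p v \<bullet> v\<bar> \<le> K"
  shows "norm (grad p) \<le> K / \<bar>c\<bar>"
proof -
  have "\<bar>mean_curvature P p\<bar> * norm (grad p) \<le> K"
    using assms grad_nonzero card_ge
    by (intro mean_curvature_bound[OF gradient_P grad_has_derivative])
  moreover have "mean_curvature P p = c"
    using assms(1) by (intro mean_curvature_P) (simp add: zero_set_def P_eq)
  ultimately show ?thesis using c_nonzero by (simp add: field_simps)
qed

lemma hess_bound:
  obtains K where "\<And>p v. norm v = 1 \<Longrightarrow> \<bar>hess p v \<bullet> v\<bar> \<le> K * (1 + norm p)"
proof -
  obtain K1 where K1: "K1 > 0" "\<And>u v. norm (\<sigma> u v) \<le> norm u * norm v * K1"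
    using bounded_bilinear.pos_bounded[OF bounded_bilinear_\<sigma>] by blast
  obtain K2 where K2: "K2 > 0" "\<And>v. norm (A v) \<le> norm v * K2"
    using bounded_linear.pos_bounded[OF bounded_linear_A] by blast
  have "\<bar>hess p v \<bullet> v\<bar> \<le> (6 * K1 + 2 * K2) * (1 + norm p)" if v: "norm v = 1" for p v
  proof -
    have "\<bar>hess p v \<bullet> v\<bar> \<le> norm (hess p v)"
      using Cauchy_Schwarz_ineq2[of "hess p v" v] v by simp
    also have "\<dots> \<le> 6 * norm (\<sigma> p v) + 2 * norm (A v)"
      unfolding hess_def by (rule norm_triangle_le) simp
    also have "\<dots> \<le> 6 * (norm p * K1) + 2 * K2"
      using K1(2)[of p v] K2(2)[of v] v by simp
    also have "\<dots> \<le> (6 * K1 + 2 * K2) * (1 + norm p)"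
      using K1(1) K2(1) by (simp add: algebra_simps)
    finally show ?thesis .
  qed
  then show ?thesis using that by blast
qed

text \<open>If the second derivative vanished on tangent vectors, \<open>grad_bound\<close> would
  apply with bound 0 and contradict regularity.\<close>

lemma not_totally_geodesic:
  assumes "poly p = 0" "\<And>v. grad p \<bullet> v = 0 \<Longrightarrow> hess p v \<bullet> v = 0"
  shows False
  using grad_bound[OF assms(1), of 0] assms grad_nonzero by simp

text \<open>The second derivative depends on \<open>p\<close> only through
  \<open>e \<bullet> p\<close>, which sharpens the gradient bound to one in
  \<open>1 + \<bar>e \<bullet> p\<bar>\<close>. By \<open>cube_depends_on_one_variable\<close> the
  tangent spaces are then orthogonal to \<open>e\<close>, and the second derivative vanishes on
  them.\<close>

lemma leading_form_not_cube:
  assumes \<sigma>: "\<And>u v. \<sigma> u v = ((e \<bullet> u) * (e \<bullet> v)) *\<^sub>R e" and e: "e \<noteq> 0"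
  shows False
proof -
  obtain K2 where K2: "K2 > 0" "\<And>v. norm (A v) \<le> norm v * K2"
    using bounded_linear.pos_bounded[OF bounded_linear_A] by blast
  define K where "K = 6 * (norm e)\<^sup>2 + 2 * K2"
  have "\<bar>hess p v \<bullet> v\<bar> \<le> K * (1 + \<bar>e \<bullet> p\<bar>)" if v: "norm v = 1" for p v
  proof -
    have "\<bar>e \<bullet> v\<bar> \<le> norm e" using Cauchy_Schwarz_ineq2[of e v] v by simp
    then have ev: "(e \<bullet> v)\<^sup>2 \<le> (norm e)\<^sup>2" by (simp add: abs_le_square_iff[symmetric])
    have Av: "\<bar>A v \<bullet> v\<bar> \<le> K2"
      using Cauchy_Schwarz_ineq2[of "A v" v] K2(2)[of v] v by simp
    have "hess p v \<bullet> v = 6 * ((e \<bullet> p) * (e \<bullet> v)\<^sup>2) + 2 * (A v \<bullet> v)"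
      by (simp add: hess_def \<sigma> inner_add_left power2_eq_square mult.assoc)
    then have "\<bar>hess p v \<bullet> v\<bar> \<le> 6 * (\<bar>e \<bullet> p\<bar> * (e \<bullet> v)\<^sup>2) + 2 * \<bar>A v \<bullet> v\<bar>"
      by (simp add: abs_mult order_trans[OF abs_triangle_ineq])
    also have "\<dots> \<le> 6 * (\<bar>e \<bullet> p\<bar> * (norm e)\<^sup>2) + 2 * K2"
      using Av ev by (intro add_mono mult_left_mono) auto
    also have "\<dots> \<le> K * (1 + \<bar>e \<bullet> p\<bar>)"
      using K2(1) by (simp add: K_def algebra_simps)
    finally show ?thesis .
  qed
  then have bd: "norm (grad p) \<le> K / \<bar>c\<bar> * (1 + \<bar>e \<bullet> p\<bar>)" if "poly p = 0" for p
    using grad_bound[OF that, of "K * (1 + \<bar>e \<bullet> p\<bar>)"] by simp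
  obtain p where p: "poly p = 0" using nonempty by (auto simp: zero_set_def P_eq)
  obtain k where k: "grad p = k *\<^sub>R e"
    using cube_depends_on_one_variable(1)[OF \<sigma> e bd] by blast
  show False
  proof (rule not_totally_geodesic[OF p])
    fix v assume "grad p \<bullet> v = 0"
    then have ev: "e \<bullet> v = 0" using grad_nonzero[OF p] k by auto
    then have "A v = 0" using cube_depends_on_one_variable(2)[OF \<sigma> e bd] by blast
    then show "hess p v \<bullet> v = 0" by (simp add: hess_def \<sigma> ev)
  qed
qed

text \<open>A centre exists when \<open>b\<close> lies in the range of \<open>A\<close>. The
  component \<open>z\<close> of \<open>b\<close> orthogonal to that range lies in the kernel of
  \<open>A\<close>; if non-zero, it would make the zero set a paraboloid, along which the gradient
  is unbounded.\<close>

lemma quadric_centre: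
  assumes \<sigma>: "\<And>u v. \<sigma> u v = 0"
    and bd: "\<And>p. poly p = 0 \<Longrightarrow> norm (grad p) \<le> K"
    and q: "A q \<noteq> 0"
  obtains a where "b = - 2 *\<^sub>R A a"
proof -
  have "subspace (range A)" using linear_A by (intro linear_subspace_image) auto
  then obtain w z where wz: "w \<in> range A" "b = w + z" "\<And>y. y \<in> range A \<Longrightarrow> orthogonal z y"
    using orthogonal_subspace_decomp_exists[of "range A" b] by (metis span_eq_iff)
  have zA: "z \<bullet> A y = 0" for y using wz(3) by (simp add: orthogonal_def)
  have "A z \<bullet> y = 0" for y using A_symmetric zA by simp
  then have Az: "A z = 0" using inner_eq_zero_iff by blast
  have "z = 0"
  proof (rule ccontr)
    assume z: "z \<noteq> 0"
    \<comment> \<open>The factor \<open>t\<close> makes \<open>(2 * t) *\<^sub>R A q\<close> too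
      long for the gradient bound even after adding \<open>b\<close>. Moving along \<open>z\<close>
      changes \<open>poly\<close> linearly and leaves \<open>A x\<close> unchanged, so
      \<open>s\<close> brings the point back to the zero set.\<close>
    define t where "t = (\<bar>K\<bar> + norm b + 1) / norm (A q)"
    define s where "s = - (t\<^sup>2 * (A q \<bullet> q) + t * (b \<bullet> q) + \<gamma>) / (z \<bullet> z)"
    define x where "x = t *\<^sub>R q + s *\<^sub>R z"
    have Ax: "A x = t *\<^sub>R A q" by (simp add: x_def A_simps Az)
    have "b \<bullet> z = z \<bullet> z" using wz(1) zA by (auto simp: wz(2) inner_simps inner_commute)
    moreover have "A q \<bullet> z = 0" using zA by (simp add: inner_commute)
    ultimately have "poly x = t\<^sup>2 * (A q \<bullet> q) + t * (b \<bullet> q) + \<gamma> + s * (z \<bullet> z)"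
      unfolding poly_def \<sigma> Ax by (simp add: x_def inner_add_right power2_eq_square)
    then have "poly x = 0" using z by (simp add: s_def)
    then have "norm (grad x) \<le> K" by (rule bd)
    moreover have "grad x = (2 * t) *\<^sub>R A q + b" by (simp add: grad_def \<sigma> Ax)
    moreover have "norm ((2 * t) *\<^sub>R A q) = 2 * (\<bar>K\<bar> + norm b + 1)"
      using q by (simp add: t_def)
    moreover have "norm ((2 * t) *\<^sub>R A q) \<le> norm ((2 * t) *\<^sub>R A q + b) + norm b"
      using norm_triangle_ineq4[of "(2 * t) *\<^sub>R A q + b" b] by simp
    ultimately show False using norm_ge_zero[of b] by (smt (verit))
  qed
  moreover obtain y where "w = A y" using wz(1) by blast
  ultimately have "b = - 2 *\<^sub>R A ((- 1 / 2) *\<^sub>R y)"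
    using wz(2) by (simp only: A_simps) simp
  then show ?thesis using that by blast
qed

lemma quadric_classification:
  assumes \<sigma>: "\<And>u v. \<sigma> u v = 0"
  shows "hypersphere (zero_set P) \<or> round_cylinder (zero_set P)"
proof -
  have hess: "hess p v = 2 *\<^sub>R A v" for p v by (simp add: hess_def \<sigma>)
  obtain K2 where K2: "K2 > 0" "\<And>v. norm (A v) \<le> norm v * K2"
    using bounded_linear.pos_bounded[OF bounded_linear_A] by blast
  define K where "K = 2 * K2 / \<bar>c\<bar>"
  have bd: "norm (grad p) \<le> K" if "poly p = 0" for p
    unfolding K_def
  proof (rule grad_bound[OF that])
    fix v :: "real ^ 'm" assume "norm v = 1"
    then show "\<bar>hess p v \<bullet> v\<bar> \<le> 2 * K2"
      using Cauchy_Schwarz_ineq2[of "A v" v] K2(2)[of v] by (simp add: hess)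
  qed
  obtain p where p: "poly p = 0" using nonempty by (auto simp: zero_set_def P_eq)
  obtain q where q: "A q \<noteq> 0"
    using not_totally_geodesic[OF p] hess by (metis inner_zero_left scaleR_zero_right)
  obtain a where a: "b = - 2 *\<^sub>R A a" by (rule quadric_centre[OF \<sigma> bd q])
  define \<zeta> where "\<zeta> = A a \<bullet> a - \<gamma>"
  have poly_a: "poly x = A (x - a) \<bullet> (x - a) - \<zeta>" for x
  proof -
    have "A a \<bullet> x = A x \<bullet> a" by (metis A_symmetric inner_commute)
    then show ?thesis
      unfolding poly_def \<sigma> by (simp add: a \<zeta>_def linear_diff[OF linear_A] inner_diff_left inner_diff_right)
  qed
  have grad_a: "grad x = 2 *\<^sub>R A (x - a)" for x
    unfolding grad_def \<sigma> by (simp add: a linear_diff[OF linear_A] algebra_simps)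
  have "\<zeta> \<noteq> 0"
  proof
    assume "\<zeta> = 0"
    then have "poly a = 0" by (simp add: poly_a)
    moreover have "grad a = 0" by (simp add: grad_a linear_0[OF linear_A])
    ultimately show False using grad_nonzero by blast
  qed
  define S where "S v = (1 / \<zeta>) *\<^sub>R A v" for v
  have A_S: "A v = \<zeta> *\<^sub>R S v" for v using \<open>\<zeta> \<noteq> 0\<close> by (simp add: S_def)
  have S: "linear S" "\<And>u v. S u \<bullet> v = u \<bullet> S v"
    using linear_A by (auto simp: S_def[abs_def] A_symmetric intro: linear_compose_scale_right)
  have zero: "poly (a + y) = 0 \<longleftrightarrow> S y \<bullet> y = 1" for y
    using \<open>\<zeta> \<noteq> 0\<close> by (auto simp: poly_a S_def field_simps)
  define m where "m = real (CARD('m) - 1)"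
  have "m \<noteq> 0" using card_ge by (simp add: m_def)
  obtain \<kappa> W where W: "\<kappa> > 0" "subspace W" "dim W \<ge> 2" "\<And>w. w \<in> W \<Longrightarrow> S w = \<kappa> *\<^sub>R w"
    "\<And>z. (\<And>w. w \<in> W \<Longrightarrow> z \<bullet> w = 0) \<Longrightarrow> S z = 0"
  proof (rule quadric_eigenvalues[OF S])
    show "S (p - a) \<bullet> (p - a) = 1" using zero[of "p - a"] p by simp
    show "norm (S y) \<le> K / (2 * \<bar>\<zeta>\<bar>)" if "S y \<bullet> y = 1" for y
      using bd[of "a + y"] that zero[of y] \<open>\<zeta> \<noteq> 0\<close> by (simp add: grad_a A_S abs_mult pos_le_divide_eq mult.commute)
    \<comment> \<open>The factor \<open>m\<close> undoes the averaging in the mean curvature, and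
      \<open>sgn \<zeta>\<close> corrects the orientation, since dividing the quadratic form by
      \<open>\<zeta>\<close> may reverse the normal.\<close>
    show "m * c * sgn \<zeta> \<noteq> 0" using \<open>m \<noteq> 0\<close> \<open>\<zeta> \<noteq> 0\<close> c_nonzero by (simp add: sgn_0_0)
  next
    fix \<kappa> v assume \<kappa>: "0 < \<kappa>" and v: "norm v = 1" "S v = \<kappa> *\<^sub>R v"
    \<comment> \<open>The vertex of the quadric on the axis \<open>v\<close>; the normal there is
      \<open>v\<close> or \<open>- v\<close>.\<close>
    define y where "y = (1 / sqrt \<kappa>) *\<^sub>R v"
    have Sy: "S y = sqrt \<kappa> *\<^sub>R v"
      using \<kappa> by (simp add: y_def linear_scale[OF S(1)] v(2) real_div_sqrt)
    have "S y \<bullet> y = 1" unfolding Sy using \<kappa> v(1) by (simp add: y_def dot_square_norm)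
    then have py: "poly (a + y) = 0" using zero by blast
    have gr: "grad (a + y) = (2 * \<zeta> * sqrt \<kappa>) *\<^sub>R v"
      by (simp add: grad_a A_S Sy)
    have "sgn v = v" using v(1) by (simp add: sgn_div_norm)
    then have sg: "sgn (grad (a + y)) = sgn \<zeta> *\<^sub>R v"
      unfolding gr using \<kappa> by (simp add: sgn_scaleR sgn_mult)
    have "c * m * norm (grad (a + y)) = hess (a + y) (sgn (grad (a + y))) \<bullet> sgn (grad (a + y)) - (\<Sum>b\<in>Basis. hess (a + y) b \<bullet> b)"
      using mean_curvature_trace[OF gradient_P grad_has_derivative grad_nonzero[OF py] card_ge]
        mean_curvature_P[of "a + y"] py by (simp add: m_def zero_set_def P_eq)
    also have "hess (a + y) (sgn (grad (a + y))) \<bullet> sgn (grad (a + y)) = 2 * \<zeta> * \<kappa>"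
      unfolding sg using v \<open>\<zeta> \<noteq> 0\<close>
      by (simp add: hess A_S linear_scale[OF S(1)] dot_square_norm sgn_if)
    also have "(\<Sum>b\<in>Basis. hess (a + y) b \<bullet> b) = 2 * \<zeta> * (\<Sum>b\<in>Basis. S b \<bullet> b)"
      by (simp add: hess A_S sum_distrib_left mult.assoc)
    also have "norm (grad (a + y)) = 2 * \<bar>\<zeta>\<bar> * sqrt \<kappa>"
      unfolding gr using v(1) \<kappa> by (simp add: abs_mult)
    finally have "c * m * (2 * \<bar>\<zeta>\<bar> * sqrt \<kappa>) = 2 * \<zeta> * (\<kappa> - (\<Sum>b\<in>Basis. S b \<bullet> b))"
      by (simp add: algebra_simps)
    then have "(2 * \<zeta>) * (m * c * sgn \<zeta> * sqrt \<kappa>) = (2 * \<zeta>) * (\<kappa> - (\<Sum>b\<in>Basis. S b \<bullet> b))"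
      by (simp only: abs_sgn[of \<zeta>] mult_ac)
    then show "m * c * sgn \<zeta> * sqrt \<kappa> = \<kappa> - (\<Sum>b\<in>Basis. S b \<bullet> b)"
      using \<open>\<zeta> \<noteq> 0\<close> by simp
  qed blast
  have "zero_set P = {x. S (x - a) \<bullet> (x - a) = 1}"
  proof -
    have "poly x = 0 \<longleftrightarrow> S (x - a) \<bullet> (x - a) = 1" for x
      using zero[of "x - a"] by simp
    then show ?thesis by (simp add: zero_set_def P_eq)
  qed
  then show ?thesis
    using umbilic_quadric_classification[OF S(1) W] by simp
qed

end

subsection \<open>Cubic polynomial functions in invariant form\<close>

text \<open>Spelling a monomial as a list of variables turns the condition that its degree is at
  most three into four cases for the list.\<close>

lemma monomial_eq_prod_list:
  fixes \<alpha> :: "'m::finite \<Rightarrow> nat"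
  shows "\<exists>is. length is = (\<Sum>i\<in>UNIV. \<alpha> i) \<and> (\<forall>x :: real ^ 'm. (\<Prod>i\<in>UNIV. (x $ i) ^ \<alpha> i) = prod_list (map (\<lambda>i. x $ i) is))"
proof (induction "\<Sum>i\<in>UNIV. \<alpha> i" arbitrary: \<alpha>)
  case 0
  then have "\<alpha> i = 0" for i by simp
  then show ?case by simp
next
  case (Suc d)
  then obtain j where j: "\<alpha> j \<noteq> 0" by (metis nat.distinct(1) sum.neutral)
  define \<beta> where "\<beta> = \<alpha>(j := \<alpha> j - 1)"
  have "(\<Sum>i\<in>UNIV. \<alpha> i) = \<alpha> j + (\<Sum>i\<in>UNIV - {j}. \<alpha> i)" by (intro sum.remove) auto
  moreover have "(\<Sum>i\<in>UNIV. \<beta> i) = \<beta> j + (\<Sum>i\<in>UNIV - {j}. \<beta> i)" by (intro sum.remove) auto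
  moreover have "(\<Sum>i\<in>UNIV - {j}. \<beta> i) = (\<Sum>i\<in>UNIV - {j}. \<alpha> i)" by (intro sum.cong) (auto simp: \<beta>_def)
  ultimately have d: "d = (\<Sum>i\<in>UNIV. \<beta> i)" using Suc(2) j by (simp add: \<beta>_def)
  obtain "is" where "is": "length is = d" "\<forall>x :: real ^ 'm. (\<Prod>i\<in>UNIV. (x $ i) ^ \<beta> i) = prod_list (map (\<lambda>i. x $ i) is)"
    using Suc(1)[OF d] d by auto
  have "(\<Prod>i\<in>UNIV. (x $ i) ^ \<alpha> i) = x $ j * (\<Prod>i\<in>UNIV. (x $ i) ^ \<beta> i)" for x :: "real ^ 'm"
  proof -
    have "(\<Prod>i\<in>UNIV. (x $ i) ^ \<alpha> i) = (x $ j) ^ \<alpha> j * (\<Prod>i\<in>UNIV - {j}. (x $ i) ^ \<alpha> i)"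
      by (intro prod.remove) auto
    also have "(x $ j) ^ \<alpha> j = x $ j * (x $ j) ^ \<beta> j"
      using j by (simp add: \<beta>_def power_Suc[symmetric])
    also have "(\<Prod>i\<in>UNIV - {j}. (x $ i) ^ \<alpha> i) = (\<Prod>i\<in>UNIV - {j}. (x $ i) ^ \<beta> i)"
      by (intro prod.cong) (auto simp: \<beta>_def)
    also have "x $ j * (x $ j) ^ \<beta> j * (\<Prod>i\<in>UNIV - {j}. (x $ i) ^ \<beta> i) = x $ j * (\<Prod>i\<in>UNIV. (x $ i) ^ \<beta> i)"
      by (subst prod.remove[of UNIV j]) auto
    finally show ?thesis .
  qed
  then show ?case using "is" Suc(2) by (intro exI[of _ "j # is"]) auto
qed

text \<open>The coefficients are hidden so that closure under sums and scalar multiples can be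
  stated for functions alone.\<close>

definition is_cubic :: "('a::euclidean_space \<Rightarrow> real) \<Rightarrow> bool" where
  "is_cubic P \<longleftrightarrow> (\<exists>\<sigma> A b \<gamma>. cubic_function \<sigma> A \<and> P = cubic_function.poly \<sigma> A b \<gamma>)"

lemma is_cubicI:
  assumes "cubic_function \<sigma> A" "\<And>x. P x = \<sigma> x x \<bullet> x + A x \<bullet> x + b \<bullet> x + \<gamma>"
  shows "is_cubic P"
  unfolding is_cubic_def using assms
  by (intro exI[of _ \<sigma>] exI[of _ A] exI[of _ b] exI[of _ \<gamma>]) (auto simp: cubic_function.poly_def)

lemma cubic_function_add:
  assumes "cubic_function \<sigma> A" "cubic_function \<tau> B"
  shows "cubic_function (\<lambda>u v. \<sigma> u v + \<tau> u v) (\<lambda>u. A u + B u)"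
proof -
  interpret s: cubic_function \<sigma> A by (rule assms)
  interpret t: cubic_function \<tau> B by (rule assms)
  show ?thesis
  proof (rule cubic_function.intro)
    show "bilinear (\<lambda>u v. \<sigma> u v + \<tau> u v)"
      using s.bil t.bil by (auto simp: bilinear_def intro: linear_compose_add)
    show "linear (\<lambda>u. A u + B u)" using s.linear_A t.linear_A by (rule linear_compose_add)
    show "\<sigma> u v + \<tau> u v = \<sigma> v u + \<tau> v u" for u v
      using s.\<sigma>_commute[of u v] t.\<sigma>_commute[of u v] by simp
    show "(\<sigma> u v + \<tau> u v) \<bullet> w = (\<sigma> u w + \<tau> u w) \<bullet> v" for u v w
      using s.\<sigma>_symmetric[of u v w] t.\<sigma>_symmetric[of u v w] by (simp add: inner_add_left)
    show "(A u + B u) \<bullet> v = u \<bullet> (A v + B v)" for u v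
      using s.A_symmetric[of u v] t.A_symmetric[of u v] by (simp add: inner_add_left inner_add_right)
  qed
qed

lemma cubic_function_scale:
  assumes "cubic_function \<sigma> A"
  shows "cubic_function (\<lambda>u v. k *\<^sub>R \<sigma> u v) (\<lambda>u. k *\<^sub>R A u)"
proof -
  interpret s: cubic_function \<sigma> A by (rule assms)
  show ?thesis
  proof (rule cubic_function.intro)
    show "bilinear (\<lambda>u v. k *\<^sub>R \<sigma> u v)"
      using s.bil by (auto simp: bilinear_def intro: linear_compose_scale_right)
    show "linear (\<lambda>u. k *\<^sub>R A u)" using s.linear_A by (rule linear_compose_scale_right)
    show "k *\<^sub>R \<sigma> u v = k *\<^sub>R \<sigma> v u" for u v using s.\<sigma>_commute[of u v] by simp
    show "k *\<^sub>R \<sigma> u v \<bullet> w = k *\<^sub>R \<sigma> u w \<bullet> v" for u v w using s.\<sigma>_symmetric[of u v w] by simp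
    show "k *\<^sub>R A u \<bullet> v = u \<bullet> k *\<^sub>R A v" for u v using s.A_symmetric[of u v] by simp
  qed
qed

lemma is_cubic_add:
  assumes "is_cubic P" "is_cubic Q"
  shows "is_cubic (\<lambda>x. P x + Q x)"
proof -
  obtain \<sigma> A b \<gamma> where P: "cubic_function \<sigma> A" "P = cubic_function.poly \<sigma> A b \<gamma>"
    using assms(1) unfolding is_cubic_def by blast
  obtain \<tau> B d \<delta> where Q: "cubic_function \<tau> B" "Q = cubic_function.poly \<tau> B d \<delta>"
    using assms(2) unfolding is_cubic_def by blast
  show ?thesis
    by (rule is_cubicI[OF cubic_function_add[OF P(1) Q(1)], where b = "b + d" and \<gamma> = "\<gamma> + \<delta>"])
       (simp add: P(2) Q(2) cubic_function.poly_def[OF P(1)] cubic_function.poly_def[OF Q(1)] inner_add_left)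
qed

lemma is_cubic_scale:
  assumes "is_cubic P"
  shows "is_cubic (\<lambda>x. k * P x)"
proof -
  obtain \<sigma> A b \<gamma> where P: "cubic_function \<sigma> A" "P = cubic_function.poly \<sigma> A b \<gamma>"
    using assms unfolding is_cubic_def by blast
  show ?thesis
    by (rule is_cubicI[OF cubic_function_scale[OF P(1)], where b = "k *\<^sub>R b" and \<gamma> = "k * \<gamma>"])
       (simp add: P(2) cubic_function.poly_def[OF P(1)] distrib_left)
qed

lemma cubic_function_zero: "cubic_function (\<lambda>u v. 0) (\<lambda>u. 0)"
  by standard (auto simp: bilinear_def linear_zero)

lemma is_cubic_const: "is_cubic (\<lambda>x. k)"
  by (rule is_cubicI[OF cubic_function_zero, where b = 0 and \<gamma> = k]) simp

lemma is_cubic_inner: "is_cubic (\<lambda>x. p \<bullet> x)"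
  by (rule is_cubicI[OF cubic_function_zero, where b = p and \<gamma> = 0]) simp

lemma is_cubic_inner2: "is_cubic (\<lambda>x. (p \<bullet> x) * (q \<bullet> x))"
proof (rule is_cubicI[where b = 0 and \<gamma> = 0])
  show "cubic_function (\<lambda>u v. 0) (\<lambda>u. (1 / 2) *\<^sub>R ((p \<bullet> u) *\<^sub>R q + (q \<bullet> u) *\<^sub>R p))"
    by standard (auto simp: bilinear_def linear_zero linear_iff algebra_simps inner_simps inner_commute)
qed (simp add: inner_simps)

text \<open>The bilinear map comes from averaging the product over the six permutations of
  \<open>p\<close>, \<open>q\<close>, \<open>r\<close>; each of its three vector terms collects two
  permutations.\<close>

lemma is_cubic_inner3: "is_cubic (\<lambda>x. (p \<bullet> x) * (q \<bullet> x) * (r \<bullet> x))"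
proof (rule is_cubicI[where b = 0 and \<gamma> = 0])
  show "cubic_function (\<lambda>u v. (1 / 6) *\<^sub>R (
      ((p \<bullet> u) * (q \<bullet> v) + (p \<bullet> v) * (q \<bullet> u)) *\<^sub>R r +
      ((p \<bullet> u) * (r \<bullet> v) + (p \<bullet> v) * (r \<bullet> u)) *\<^sub>R q +
      ((q \<bullet> u) * (r \<bullet> v) + (q \<bullet> v) * (r \<bullet> u)) *\<^sub>R p)) (\<lambda>u. 0)"
    by standard (auto simp: bilinear_def linear_zero linear_iff algebra_simps add_divide_distrib inner_simps inner_commute)
qed (simp add: inner_simps algebra_simps)

lemma is_cubic_sum: "finite I \<Longrightarrow> (\<And>i. i \<in> I \<Longrightarrow> is_cubic (f i)) \<Longrightarrow> is_cubic (\<lambda>x. \<Sum>i\<in>I. f i x)"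
  by (induction I rule: finite_induct) (auto intro: is_cubic_const is_cubic_add)

lemma polynomial_degree_le_3_is_cubic:
  assumes "polynomial_degree_le 3 P"
  shows "is_cubic P"
proof -
  obtain a where P: "P = (\<lambda>x. \<Sum>\<alpha> | (\<Sum>i\<in>UNIV. \<alpha> i) \<le> 3. a \<alpha> * (\<Prod>i\<in>UNIV. (x $ i) ^ \<alpha> i))"
    using assms unfolding polynomial_degree_le_def by blast
  have "is_cubic (\<lambda>x. \<Prod>i\<in>UNIV. (x $ i) ^ \<alpha> i)" if "(\<Sum>i\<in>UNIV. \<alpha> i) \<le> 3" for \<alpha> :: "'a \<Rightarrow> nat"
  proof -
    obtain "is" where "length is = (\<Sum>i\<in>UNIV. \<alpha> i)"
      and prod: "\<forall>x :: real ^ 'a. (\<Prod>i\<in>UNIV. (x $ i) ^ \<alpha> i) = prod_list (map (\<lambda>i. x $ i) is)"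
      using monomial_eq_prod_list[of \<alpha>] by blast
    then have len: "length is \<le> 3" using that by simp
    have ax: "x $ i = axis i 1 \<bullet> x" for x :: "real ^ 'a" and i by (simp add: inner_axis')
    consider "is = []" | i where "is = [i]" | i j where "is = [i, j]" | i j k where "is = [i, j, k]"
      using len by (auto simp: le_Suc_eq numeral_3_eq_3 length_Suc_conv)
    then show ?thesis
    proof cases
      case 1
      then show ?thesis unfolding prod[rule_format] by (simp add: is_cubic_const)
    next
      case 2
      then show ?thesis unfolding prod[rule_format] by (simp add: ax is_cubic_inner)
    next
      case 3
      then show ?thesis unfolding prod[rule_format] by (simp add: ax is_cubic_inner2)
    next
      case 4
      then show ?thesis unfolding prod[rule_format] by (simp add: ax is_cubic_inner3 mult.assoc[symmetric])
    qed
  qed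
  then show ?thesis
    unfolding P by (intro is_cubic_sum is_cubic_scale finite_multi_indices) simp
qed

section \<open>The classification, by cases on the cubic part\<close>

theorem theorem1p2:
  fixes P :: "real ^ 'm \<Rightarrow> real" and n :: nat
  assumes "n \<ge> 2"
    and "CARD('m) = n + 1"
    and "polynomial_degree_le 3 P"
    and "zero_set P \<noteq> {}"
    and "regular_hypersurface P"
    and "nonzero_constant_mean_curvature P"
  shows "hypersphere (zero_set P) \<or> round_cylinder (zero_set P)"
proof -
  obtain c where c: "c \<noteq> 0" "\<And>p. p \<in> zero_set P \<Longrightarrow> mean_curvature P p = c"
    using assms(6) unfolding nonzero_constant_mean_curvature_def by blast
  have cmc: "cmc_cubic \<sigma> A b \<gamma> P c" if "cubic_function \<sigma> A" "P = cubic_function.poly \<sigma> A b \<gamma>" for \<sigma> A b \<gamma>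
    using that assms c by (intro cmc_cubic.intro cmc_cubic_axioms.intro) auto
  obtain \<sigma> A b \<gamma> where cub: "cubic_function \<sigma> A" and P: "P = cubic_function.poly \<sigma> A b \<gamma>"
    using polynomial_degree_le_3_is_cubic[OF assms(3)] unfolding is_cubic_def by blast
  interpret cmc_cubic \<sigma> A b \<gamma> P c by (rule cmc[OF cub P])
  show ?thesis
  proof (cases "\<forall>x. \<sigma> x x \<bullet> x = 0")
    \<comment> \<open>The function \<open>poly\<close> sees only the diagonal of
      \<open>\<sigma>\<close>, so a vanishing cubic form lets \<open>P\<close> be presented with
      \<open>\<sigma>\<close> replaced by 0.\<close>
    case True
    have "cubic_function (\<lambda>u v. 0) A"
      using cubic_function_zero[where ?'a = "real ^ 'm"] cub unfolding cubic_function_def by auto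
    moreover from this have "P = cubic_function.poly (\<lambda>u v. 0) A b \<gamma>"
      using True by (simp add: P fun_eq_iff poly_def cubic_function.poly_def[of "\<lambda>u v. 0" A])
    ultimately interpret quadric: cmc_cubic "\<lambda>u v. 0" A b \<gamma> P c
      by (rule cmc)
    show ?thesis by (rule quadric.quadric_classification) simp
  next
    case False
    then obtain w where w: "\<sigma> w w \<bullet> w \<noteq> 0" by blast
    \<comment> \<open>Normalises the leading form to 1 at \<open>v\<close>. The cube root is odd, so
      a negative value at \<open>w\<close> is allowed.\<close>
    define v where "v = (1 / root 3 (\<sigma> w w \<bullet> w)) *\<^sub>R w"
    have v: "\<sigma> v v \<bullet> v = 1"
    proof -
      define k where "k = root 3 (\<sigma> w w \<bullet> w)"
      have "k ^ 3 = \<sigma> w w \<bullet> w" by (simp add: k_def odd_real_root_pow)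
      moreover have "\<sigma> v v \<bullet> v = (\<sigma> w w \<bullet> w) / k ^ 3"
        by (simp add: v_def k_def[symmetric] \<sigma>_simps power3_eq_cube)
      ultimately show ?thesis using w by simp
    qed
    define e where "e = \<sigma> v v"
    obtain K where K: "\<And>p v. norm v = 1 \<Longrightarrow> \<bar>hess p v \<bullet> v\<bar> \<le> K * (1 + norm p)"
      using hess_bound by blast
    have "norm (grad p) \<le> K / \<bar>c\<bar> * (1 + norm p)" if "poly p = 0" for p
      using grad_bound[OF that, of "K * (1 + norm p)"] K by simp
    then have cube: "\<sigma> x x \<bullet> x = (e \<bullet> x) ^ 3" for x
      unfolding e_def using leading_form_singular v by (intro leading_form_cube) blast+
    \<comment> \<open>Agreement of the cubic forms on the diagonal, given by \<open>cube\<close>,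
      suffices to present \<open>P\<close> with this trilinear form in place of
      \<open>\<sigma>\<close>.\<close>
    have "cubic_function (\<lambda>u v. ((e \<bullet> u) * (e \<bullet> v)) *\<^sub>R e) (\<lambda>u. 0)"
      by standard (auto simp: bilinear_def linear_zero linear_iff algebra_simps inner_simps)
    then have "cubic_function (\<lambda>u v. ((e \<bullet> u) * (e \<bullet> v)) *\<^sub>R e) A"
      using cub unfolding cubic_function_def by auto
    moreover from this have "P = cubic_function.poly (\<lambda>u v. ((e \<bullet> u) * (e \<bullet> v)) *\<^sub>R e) A b \<gamma>"
      by (simp add: P fun_eq_iff poly_def cubic_function.poly_def[of "\<lambda>u v. ((e \<bullet> u) * (e \<bullet> v)) *\<^sub>R e" A]
          cube power3_eq_cube)
    ultimately interpret cube: cmc_cubic "\<lambda>u v. ((e \<bullet> u) * (e \<bullet> v)) *\<^sub>R e" A b \<gamma> P c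
      by (rule cmc)
    have "e \<noteq> 0" using v by (auto simp: e_def)
    then show ?thesis using cube.leading_form_not_cube by blast
  qed
qed

end
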